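(* Let $\{a_n\}_{n\ge0}$ be a sequence of non-negative real numbers, let $\{\xi_n\}_{n\ge0}$ be i.i.d. standard complex Gaussian random variables, and let $G(z)=\sum_{n=0}^\infty a_n\xi_nz^n$. For $k\ge 0$ let $\sigma_k^2=\sum_{n=2^k}^{2^{k+1}-1}a_n^2$. If $$\sum_{k=1}^\infty\ \sup_{n\ge k}\{\sigma_n^2\}<\infty,$$ then almost surely $G\in\mathrm{SL}$, where $\mathrm{SL}$ is the Sledd space.
   Context: A standard complex Gaussian has density $\frac1\pi e^{-|z|^2}$ on $\mathbb{C}$. $H^1$ is the Hardy space of the unit disk. For $N\ge0$ let $K_N(z)=\sum_{k=-N}^N\big(1-\frac{|k|}{N+1}\big)z^k$ ($|z|=1$) be the Fejér kernel. The dyadic trapezoidal kernels are $$T_0(z)=1+\tfrac12z+\tfrac12z^{-1},\qquad T_n=2K_{2^{n+2}-1}-K_{2^{n+1}-1}+K_{2^{n-1}-1}-2K_{2^n-1}\quad(n\ge1).$$ For $n\ge1$, $\widehat{T_n}$ restricted to non-negative integers is supported in $[2^{n-1},2^{n+2})$, takes values in $[0,1]$, and equals $1$ on $[2^n,2^{n+1}]$. The symbol $\star$ denotes convolution on the unit circle: $(T_n\star F)(x)=\sum_k\widehat{T_n}(k)\widehat F(k)x^k$, where $\widehat F(k)$ is the $k$-th Fourier (Laurent/Taylor) coefficient. The Sledd seminorm of $F\in H^1$ is given by $$\|F\|_{S(T)}^2=\sup_{|x|=1}\sum_{n=0}^\infty|T_n\star F(x)|^2,$$ and $\mathrm{SL}=\{F\in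 H^1:\|F\|_{S(T)}<\infty\}$. *)

theory Defs
  imports "HOL-Probability.Probability" "HOL-Complex_Analysis.Complex_Analysis"
begin

section \<open>Gaussian variables and dyadic blocks\<close>

definition std_complex_gaussian_density :: "complex \<Rightarrow> ennreal" where
  "std_complex_gaussian_density z = ennreal (exp (- (norm z)\<^sup>2) / pi)"

definition dyadic_sq_sum :: "(nat \<Rightarrow> real) \<Rightarrow> nat \<Rightarrow> real" where
  "dyadic_sq_sum a k = (\<Sum>n\<in>{2 ^ k..<2 ^ (k + 1)}. (a n)\<^sup>2)"

section \<open>The Hardy space\<close>

text \<open>Elements of \<open>H\<^sup>1\<close> are represented by total functions; only the values on the open unit
  disk \<^term>\<open>ball (0::complex) 1\<close> matter.\<close>

definition hardy1_norm :: "(complex \<Rightarrow> complex) \<Rightarrow> ennreal" where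
  "hardy1_norm F = (SUP r\<in>{0..<1::real}.
     (\<integral>\<^sup>+t\<in>{0..2 * pi}. ennreal (norm (F (of_real r * cis t)) / (2 * pi)) \<partial>lborel))"

definition hardy1 :: "(complex \<Rightarrow> complex) set" where
  "hardy1 = {F. F holomorphic_on ball 0 1 \<and> hardy1_norm F < \<infinity>}"

text \<open>The Taylor coefficients at 0, extended by 0 to negative indices, are the Fourier coefficients
  of the boundary function of an element of \<open>H\<^sup>1\<close>.\<close>

definition taylor_coeff :: "(complex \<Rightarrow> complex) \<Rightarrow> int \<Rightarrow> complex" where
  "taylor_coeff F k = (if k < 0 then 0 else (deriv ^^ nat k) F 0 / fact (nat k))"

section \<open>Trapezoidal kernels and the Sledd space\<close>

definition fejer_kernel :: "nat \<Rightarrow> complex \<Rightarrow> complex" where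
  "fejer_kernel N z =
     (\<Sum>k\<in>{- int N..int N}. of_real (1 - real_of_int \<bar>k\<bar> / (real N + 1)) * z powi k)"

definition trapezoidal_kernel :: "nat \<Rightarrow> complex \<Rightarrow> complex" where
  "trapezoidal_kernel n z =
     (if n = 0 then 1 + z / 2 + inverse z / 2
      else 2 * fejer_kernel (2 ^ (n + 2) - 1) z - fejer_kernel (2 ^ (n + 1) - 1) z
           + fejer_kernel (2 ^ (n - 1) - 1) z - 2 * fejer_kernel (2 ^ n - 1) z)"

definition fourier_coeff :: "(complex \<Rightarrow> complex) \<Rightarrow> int \<Rightarrow> complex" where
  "fourier_coeff f k = (LBINT t:{0..2 * pi}. f (cis t) * cis (- (of_int k * t))) / (2 * pi)"

text \<open>Convolution of a function \<open>T\<close> on the circle with a function \<open>F\<close> on the disk. It is used for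
  trigonometric polynomials \<open>T\<close> only, for which all but finitely many terms of the sum vanish.\<close>

definition circle_conv :: "(complex \<Rightarrow> complex) \<Rightarrow> (complex \<Rightarrow> complex) \<Rightarrow> complex \<Rightarrow> complex" where
  "circle_conv T F x = (\<Sum>\<^sub>\<infinity>k::int. fourier_coeff T k * taylor_coeff F k * x powi k)"

text \<open>The square of the Sledd seminorm, as an extended non-negative number.\<close>

definition sledd_seminorm_sq :: "(complex \<Rightarrow> complex) \<Rightarrow> ennreal" where
  "sledd_seminorm_sq F =
     (SUP x\<in>sphere 0 1. \<Sum>n. ennreal ((norm (circle_conv (trapezoidal_kernel n) F x))\<^sup>2))"

definition sledd_space :: "(complex \<Rightarrow> complex) set" where
  "sledd_space = {F \<in> hardy1. sledd_seminorm_sq F < \<infinity>}"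

section \<open>Gaussian analytic functions\<close>

definition gaussian_series :: "(nat \<Rightarrow> real) \<Rightarrow> (nat \<Rightarrow> 'w \<Rightarrow> complex) \<Rightarrow> 'w \<Rightarrow> complex \<Rightarrow> complex" where
  "gaussian_series a \<xi> \<omega> z = (\<Sum>n. of_real (a n) * \<xi> n \<omega> * z ^ n)"

end

theory Submission
  imports Defs
begin

text \<open>With \<open>b m\<close> a positive, decreasing, summable majorant of the \<open>\<sigma>\<^sub>m\<^sup>2\<close>, put
  \<open>Y m x = |(T\<^bsub>m+1\<^esub> \<star> G) x|\<^sup>2 / b m\<close>. Each \<open>Y m x\<close> is the squared modulus of a complex Gaussian of
  bounded variance, and it involves only the coefficients in \<open>[2^m, 2^(m+3))\<close>. Independence hence
  gives \<open>E exp (\<lambda> (Y 0 x + \<dots> + Y (N-1) x)) \<le> C^N\<close>, and a union bound over exponentially (in \<open>N\<close>)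
  many points of the circle yields \<open>Y 0 x + \<dots> + Y (N-1) x \<le> C (N+1)\<close> for all \<open>N\<close> and, by a crude
  Lipschitz estimate, for all \<open>x\<close>, almost surely. As \<open>b\<close> is decreasing, summation by parts turns this
  into a bound of \<open>\<Sum>m. b m * Y m x\<close> by a multiple of \<open>b 0 + \<Sum>m. b m\<close>. Membership in the Hardy space
  is clear since the coefficients of \<open>G\<close> are almost surely square summable.\<close>

section \<open>Exponential moments of Gaussian sums\<close>

lemma std_complex_gaussian_density_measurable [measurable]:
  "std_complex_gaussian_density \<in> borel_measurable borel"
  unfolding std_complex_gaussian_density_def by measurable

text \<open>Completing the square, \<open>|z|^2 - 2 * Re (cnj w * z) = |z - w|^2 - |w|^2\<close>,
  turns an exponential tilt of the density into a multiple of a translate.\<close>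

lemma gaussian_density_times_exp_inner:
  "std_complex_gaussian_density z * ennreal (exp (2 * Re (cnj w * z)))
     = ennreal (exp ((norm w)\<^sup>2)) * std_complex_gaussian_density (- w + z)"
proof -
  have "- (norm z)\<^sup>2 + 2 * Re (cnj w * z) = (norm w)\<^sup>2 - (norm (- w + z))\<^sup>2"
    unfolding cmod_power2 by (simp add: power2_eq_square algebra_simps)
  hence "exp (- (norm z)\<^sup>2) * exp (2 * Re (cnj w * z)) = exp ((norm w)\<^sup>2) * exp (- (norm (- w + z))\<^sup>2)"
    by (simp flip: exp_add)
  thus ?thesis
    unfolding std_complex_gaussian_density_def by (simp flip: ennreal_mult)
qed

text \<open>The factor \<open>exp (|u|^2 / 2)\<close> halves the Gaussian exponent, and the dilation
  \<open>u = sqrt 2 * z\<close> restores it.\<close>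

lemma gaussian_density_times_exp_norm_sq:
  "std_complex_gaussian_density (sqrt 2 *\<^sub>R z) * ennreal (exp ((norm (sqrt 2 *\<^sub>R z))\<^sup>2 / 2))
     = std_complex_gaussian_density z"
  unfolding std_complex_gaussian_density_def
  by (simp add: power_mult_distrib flip: ennreal_mult exp_add)

locale gaussian_sequence = prob_space M for M :: "'w measure" +
  fixes \<xi> :: "nat \<Rightarrow> 'w \<Rightarrow> complex"
  assumes indep: "indep_vars (\<lambda>_. borel) \<xi> UNIV"
    and gaussian: "\<And>n. distributed M lborel (\<xi> n) std_complex_gaussian_density"
begin

lemma \<xi>_measurable [measurable]: "\<xi> n \<in> borel_measurable M"
  using distributed_measurable[OF gaussian[of n]] by simp

lemma nn_integral_\<xi>:
  assumes [measurable]: "f \<in> borel_measurable borel"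
  shows "(\<integral>\<^sup>+\<omega>. f (\<xi> n \<omega>) \<partial>M) = (\<integral>\<^sup>+z. std_complex_gaussian_density z * f z \<partial>lborel)"
  by (subst distributed_nn_integral[OF gaussian]) auto

text \<open>The normalisation is read off from the law of \<open>\<xi> 0\<close> under a probability
  measure, so no Gaussian integral has to be evaluated.\<close>

lemma nn_integral_gaussian_density:
  "(\<integral>\<^sup>+z. std_complex_gaussian_density z \<partial>lborel) = 1"
  using nn_integral_\<xi>[of "\<lambda>_. 1" 0] by (simp add: emeasure_space_1)

lemma nn_integral_exp_inner:
  "(\<integral>\<^sup>+z. std_complex_gaussian_density z * ennreal (exp (2 * Re (cnj w * z))) \<partial>lborel)
     = ennreal (exp ((norm w)\<^sup>2))"
proof -
  have "(\<integral>\<^sup>+z. std_complex_gaussian_density (- w + z) \<partial>lborel)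
      = (\<integral>\<^sup>+z. std_complex_gaussian_density z \<partial>distr lborel borel ((+) (- w)))"
    by (subst nn_integral_distr) auto
  also have "\<dots> = 1"
    by (simp add: lborel_distr_plus nn_integral_gaussian_density)
  finally show ?thesis
    by (subst gaussian_density_times_exp_inner) (simp add: nn_integral_cmult)
qed

text \<open>After the substitution by \<open>sqrt 2\<close> the integrand is the density itself; the
  value 2 is the Jacobian of this dilation in two real dimensions.\<close>

lemma nn_integral_exp_norm_sq:
  "(\<integral>\<^sup>+z. std_complex_gaussian_density z * ennreal (exp ((norm z)\<^sup>2 / 2)) \<partial>lborel) = 2"
proof -
  have "(\<integral>\<^sup>+z. std_complex_gaussian_density z * ennreal (exp ((norm z)\<^sup>2 / 2)) \<partial>lborel)
      = 2 * (\<integral>\<^sup>+z. std_complex_gaussian_density (sqrt 2 *\<^sub>R z) * ennreal (exp ((norm (sqrt 2 *\<^sub>R z))\<^sup>2 / 2)) \<partial>lborel)"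
    by (subst lborel_affine[of "sqrt 2" 0])
      (simp_all add: nn_integral_density nn_integral_distr nn_integral_cmult)
  thus ?thesis
    unfolding gaussian_density_times_exp_norm_sq by (simp add: nn_integral_gaussian_density)
qed

text \<open>Any bound uniform in \<open>n\<close> suffices (the exact value is 1), so the
  exponential moment just computed is reused through \<open>t \<le> 2 * exp (t / 2)\<close>.\<close>

lemma nn_integral_norm_\<xi>_sq_le: "(\<integral>\<^sup>+\<omega>. ennreal ((norm (\<xi> n \<omega>))\<^sup>2) \<partial>M) \<le> 4"
proof -
  have "(\<integral>\<^sup>+\<omega>. ennreal ((norm (\<xi> n \<omega>))\<^sup>2) \<partial>M) \<le> (\<integral>\<^sup>+\<omega>. 2 * ennreal (exp ((norm (\<xi> n \<omega>))\<^sup>2 / 2)) \<partial>M)"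
  proof (intro nn_integral_mono)
    fix \<omega>
    have "(norm (\<xi> n \<omega>))\<^sup>2 \<le> 2 * exp ((norm (\<xi> n \<omega>))\<^sup>2 / 2)"
      using exp_ge_add_one_self[of "(norm (\<xi> n \<omega>))\<^sup>2 / 2"] by linarith
    from ennreal_leI[OF this]
    show "ennreal ((norm (\<xi> n \<omega>))\<^sup>2) \<le> 2 * ennreal (exp ((norm (\<xi> n \<omega>))\<^sup>2 / 2))"
      by (simp add: ennreal_mult)
  qed
  also have "\<dots> = 4"
    by (subst nn_integral_cmult, simp, subst nn_integral_\<xi>) (auto simp: nn_integral_exp_norm_sq)
  finally show ?thesis .
qed

text \<open>Linearisation: \<open>exp (|Z|\<^sup>2)\<close> is the Gaussian average of \<open>exp (2 * Re (cnj Z * z))\<close> over \<open>z\<close>, which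
  factors over the independent summands of \<open>Z\<close>.\<close>

lemma nn_integral_exp_norm_sq_sum_le:
  assumes "finite K" and c: "(\<Sum>k\<in>K. (norm (c k))\<^sup>2) \<le> 1 / 2"
  shows "(\<integral>\<^sup>+\<omega>. ennreal (exp ((norm (\<Sum>k\<in>K. c k * \<xi> k \<omega>))\<^sup>2)) \<partial>M) \<le> 2"
proof -
  let ?g = std_complex_gaussian_density
  let ?Z = "\<lambda>\<omega>. \<Sum>k\<in>K. c k * \<xi> k \<omega>"
  interpret pair_sigma_finite lborel M ..
  have split: "ennreal (exp (2 * Re (cnj (?Z \<omega>) * z)))
      = (\<Prod>k\<in>K. ennreal (exp (2 * Re (cnj (cnj (c k) * z) * \<xi> k \<omega>))))" for z \<omega>
  proof -
    have "Re (cnj (?Z \<omega>) * z) = Re (?Z \<omega> * cnj z)"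
      by (metis cnj.sel(1) complex_cnj_cnj complex_cnj_mult)
    hence "2 * Re (cnj (?Z \<omega>) * z) = (\<Sum>k\<in>K. 2 * Re (cnj (cnj (c k) * z) * \<xi> k \<omega>))"
      by (simp only: sum_distrib_right sum_distrib_left Re_sum) (simp add: mult_ac)
    thus ?thesis
      by (simp add: exp_sum[OF \<open>finite K\<close>] prod_ennreal)
  qed
  have "(\<integral>\<^sup>+\<omega>. ennreal (exp ((norm (?Z \<omega>))\<^sup>2)) \<partial>M)
      = (\<integral>\<^sup>+\<omega>. (\<integral>\<^sup>+z. ?g z * ennreal (exp (2 * Re (cnj (?Z \<omega>) * z))) \<partial>lborel) \<partial>M)"
    by (simp only: nn_integral_exp_inner)
  also have "\<dots> = (\<integral>\<^sup>+z. (\<integral>\<^sup>+\<omega>. ?g z * ennreal (exp (2 * Re (cnj (?Z \<omega>) * z))) \<partial>M) \<partial>lborel)"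
  proof (rule Fubini')
    have [measurable]: "cnj \<in> borel_measurable borel"
      by (intro borel_measurable_continuous_onI continuous_intros)
    have "(\<lambda>(z, \<omega>). ?g z * ennreal (exp (2 * Re (cnj (?Z \<omega>) * z)))) \<in> borel_measurable (borel \<Otimes>\<^sub>M M)"
      by measurable
    thus "(\<lambda>(z, \<omega>). ?g z * ennreal (exp (2 * Re (cnj (?Z \<omega>) * z)))) \<in> borel_measurable (lborel \<Otimes>\<^sub>M M)"
      by (simp add: measurable_cong_sets[OF sets_pair_measure_cong[OF sets_lborel refl] refl])
  qed
  also have "\<dots> = (\<integral>\<^sup>+z. ?g z * ennreal (exp ((\<Sum>k\<in>K. (norm (c k))\<^sup>2) * (norm z)\<^sup>2)) \<partial>lborel)"
  proof (intro nn_integral_cong)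
    fix z
    have "(\<integral>\<^sup>+\<omega>. ?g z * ennreal (exp (2 * Re (cnj (?Z \<omega>) * z))) \<partial>M)
        = ?g z * (\<integral>\<^sup>+\<omega>. (\<Prod>k\<in>K. ennreal (exp (2 * Re (cnj (cnj (c k) * z) * \<xi> k \<omega>)))) \<partial>M)"
      by (simp only: split) (simp add: nn_integral_cmult)
    also have "(\<integral>\<^sup>+\<omega>. (\<Prod>k\<in>K. ennreal (exp (2 * Re (cnj (cnj (c k) * z) * \<xi> k \<omega>)))) \<partial>M)
        = (\<Prod>k\<in>K. \<integral>\<^sup>+\<omega>. ennreal (exp (2 * Re (cnj (cnj (c k) * z) * \<xi> k \<omega>))) \<partial>M)"
    proof (rule indep_vars_nn_integral[OF \<open>finite K\<close>])
      show "indep_vars (\<lambda>_. borel) (\<lambda>k \<omega>. ennreal (exp (2 * Re (cnj (cnj (c k) * z) * \<xi> k \<omega>)))) K"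
        by (rule indep_vars_compose2[OF indep_vars_subset[OF indep]]) auto
    qed auto
    \<comment> \<open>The same Laplace transform formula as in the linearisation, now with
      \<open>z\<close> frozen and \<open>\<xi> k\<close> as the Gaussian variable.\<close>
    also have "\<dots> = (\<Prod>k\<in>K. ennreal (exp ((norm (cnj (c k) * z))\<^sup>2)))"
      by (intro prod.cong refl, subst nn_integral_\<xi>) (auto simp only: nn_integral_exp_inner, measurable)
    also have "\<dots> = ennreal (exp ((\<Sum>k\<in>K. (norm (c k))\<^sup>2) * (norm z)\<^sup>2))"
      by (simp add: prod_ennreal sum_distrib_right exp_sum[OF \<open>finite K\<close>] norm_mult power_mult_distrib)
    finally show "(\<integral>\<^sup>+\<omega>. ?g z * ennreal (exp (2 * Re (cnj (?Z \<omega>) * z))) \<partial>M)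
        = ?g z * ennreal (exp ((\<Sum>k\<in>K. (norm (c k))\<^sup>2) * (norm z)\<^sup>2))" .
  qed
  \<comment> \<open>Here the bound \<open>1 / 2\<close> on the variance enters: it keeps the growth
    \<open>exp (s * |z|^2)\<close> below the Gaussian decay, with an explicit integral at the
    extreme case \<open>s = 1 / 2\<close>.\<close>
  also have "\<dots> \<le> (\<integral>\<^sup>+z. ?g z * ennreal (exp ((norm z)\<^sup>2 / 2)) \<partial>lborel)"
    using mult_right_mono[OF c zero_le_power2]
    by (intro nn_integral_mono mult_left_mono ennreal_leI) auto
  finally show ?thesis
    by (simp add: nn_integral_exp_norm_sq)
qed

end

text \<open>The frequency blocks \<open>[2^m, 2^(m+3))\<close> are disjoint only within a residue class of \<open>m\<close> modulo 3.\<close>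

lemma exp_sum_mod_3_le:
  fixes f :: "nat \<Rightarrow> real"
  shows "exp (\<Sum>m<N. f m) \<le> (\<Sum>r<3. exp (\<Sum>m | m < N \<and> m mod 3 = r. 3 * f m))"
proof -
  define S where "S r = (\<Sum>m | m < N \<and> m mod 3 = r. 3 * f m)" for r
  have "(\<Sum>m<N. f m) = (\<Sum>r<3. \<Sum>m\<in>{m\<in>{..<N}. m mod 3 = r}. f m)"
    by (rule sum.group[symmetric]) auto
  also have "\<dots> = (\<Sum>r<3. S r / 3)"
    by (simp add: S_def sum_distrib_left[symmetric])
  finally have eq: "(\<Sum>m<N. f m) = (S 0 + S 1 + S 2) / 3"
    by (simp add: eval_nat_numeral)
  \<comment> \<open>The sum is the mean of \<open>S 0\<close>, \<open>S 1\<close>,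
    \<open>S 2\<close>, hence at most the largest of them; the sum of the three exponentials
    dominates each one.\<close>
  consider "(\<Sum>m<N. f m) \<le> S 0" | "(\<Sum>m<N. f m) \<le> S 1" | "(\<Sum>m<N. f m) \<le> S 2"
    using eq by atomize_elim auto
  hence "exp (\<Sum>m<N. f m) \<le> exp (S 0) + exp (S 1) + exp (S 2)"
    by cases (simp_all add: add_increasing add_increasing2)
  thus ?thesis
    unfolding S_def[symmetric] by (simp add: eval_nat_numeral)
qed

lemma disjoint_family_on_dyadic_blocks:
  "disjoint_family_on (\<lambda>m. {2 ^ m..<2 ^ (m + 3)} :: nat set) {m. m < N \<and> m mod 3 = (r::nat)}"
    for N :: nat
proof -
  have disj: "{2 ^ m..<2 ^ (m + 3)} \<inter> {2 ^ n..<2 ^ (n + 3)} = ({} :: nat set)"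
    if "m mod 3 = r" "n mod 3 = r" "m < n" for m n
  proof -
    have "3 dvd n - m"
      using that mod_eq_dvd_iff_nat[of m n 3] by simp
    hence "m + 3 \<le> n"
      using dvd_imp_le[of 3 "n - m"] \<open>m < n\<close> by simp
    hence "(2::nat) ^ (m + 3) \<le> 2 ^ n"
      by (rule power_increasing) simp
    thus ?thesis by auto
  qed
  show ?thesis
    unfolding disjoint_family_on_def
  proof (intro ballI impI)
    fix m n assume "m \<in> {m. m < N \<and> m mod 3 = r}" "n \<in> {m. m < N \<and> m mod 3 = r}" "m \<noteq> n"
    thus "{2 ^ m..<2 ^ (m + 3)} \<inter> {2 ^ n..<2 ^ (n + 3)} = ({} :: nat set)"
      using disj[of m n] disj[of n m] by (cases "m < n") (auto simp: Int_commute)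
  qed
qed

section \<open>Exponential moments over several dyadic blocks\<close>

context gaussian_sequence
begin

text \<open>Each block sum is a function of the family restricted to \<open>K m\<close>.
  Disjointness of the index sets makes these restrictions independent, so the expectation factors
  and every factor is at most 2.\<close>

lemma nn_integral_exp_disjoint_blocks_le:
  assumes "finite L" and K: "\<And>m. m \<in> L \<Longrightarrow> finite (K m)" "disjoint_family_on K L"
    and c: "\<And>m. m \<in> L \<Longrightarrow> (\<Sum>k\<in>K m. (norm (c m k))\<^sup>2) \<le> 1 / 2"
  shows "(\<integral>\<^sup>+\<omega>. ennreal (exp (\<Sum>m\<in>L. (norm (\<Sum>k\<in>K m. c m k * \<xi> k \<omega>))\<^sup>2)) \<partial>M) \<le> 2 ^ card L"
proof -
  let ?f = "\<lambda>m \<omega>. ennreal (exp ((norm (\<Sum>k\<in>K m. c m k * \<xi> k \<omega>))\<^sup>2))"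
  let ?h = "\<lambda>m v. ennreal (exp ((norm (\<Sum>k\<in>K m. c m k * v k))\<^sup>2))"
  have "indep_vars (\<lambda>m. PiM (K m) (\<lambda>_. borel)) (\<lambda>m \<omega>. restrict (\<lambda>k. \<xi> k \<omega>) (K m)) L"
    by (rule indep_vars_restrict[OF indep]) (use K in auto)
  hence "indep_vars (\<lambda>_. borel) (\<lambda>m \<omega>. ?h m (restrict (\<lambda>k. \<xi> k \<omega>) (K m))) L"
    by (rule indep_vars_compose2) measurable
  hence ind: "indep_vars (\<lambda>_. borel) ?f L"
    by (simp cong: sum.cong)
  have "(\<integral>\<^sup>+\<omega>. ennreal (exp (\<Sum>m\<in>L. (norm (\<Sum>k\<in>K m. c m k * \<xi> k \<omega>))\<^sup>2)) \<partial>M)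
      = (\<integral>\<^sup>+\<omega>. (\<Prod>m\<in>L. ?f m \<omega>) \<partial>M)"
    by (simp add: exp_sum[OF \<open>finite L\<close>] prod_ennreal)
  also have "\<dots> = (\<Prod>m\<in>L. \<integral>\<^sup>+\<omega>. ?f m \<omega> \<partial>M)"
    by (rule indep_vars_nn_integral[OF \<open>finite L\<close> ind]) auto
  also have "\<dots> \<le> (\<Prod>m\<in>L. 2)"
    by (intro prod_mono_ennreal nn_integral_exp_norm_sq_sum_le K c)
  finally show ?thesis by simp
qed

text \<open>The overlapping blocks are sorted by \<open>m mod 3\<close>, at the price of a factor 3
  in the exponent. It is absorbed as \<open>sqrt 3\<close> into the coefficients, which is why the
  variance bound is \<open>1 / 6\<close>, a third of \<open>1 / 2\<close>.\<close>

lemma nn_integral_exp_dyadic_blocks_le: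
  assumes c: "\<And>m. (\<Sum>k\<in>{2 ^ m..<2 ^ (m + 3)}. (norm (c m k))\<^sup>2) \<le> 1 / 6"
  shows "(\<integral>\<^sup>+\<omega>. ennreal (exp (\<Sum>m<N. (norm (\<Sum>k\<in>{2 ^ m..<2 ^ (m + 3)}. c m k * \<xi> k \<omega>))\<^sup>2)) \<partial>M)
           \<le> 3 * 2 ^ N"
proof -
  let ?K = "\<lambda>m::nat. {2 ^ m..<2 ^ (m + 3) :: nat}"
  let ?L = "\<lambda>r::nat. {m. m < N \<and> m mod 3 = r}"
  let ?Z = "\<lambda>m \<omega>. norm (\<Sum>k\<in>?K m. c m k * \<xi> k \<omega>)"
  let ?c = "\<lambda>m k. of_real (sqrt 3) * c m k"
  have scale: "3 * (?Z m \<omega>)\<^sup>2 = (norm (\<Sum>k\<in>?K m. ?c m k * \<xi> k \<omega>))\<^sup>2" for m \<omega>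
    by (simp only: mult.assoc sum_distrib_left[symmetric])
       (simp add: norm_mult power_mult_distrib)
  have "(\<integral>\<^sup>+\<omega>. ennreal (exp (\<Sum>m<N. (?Z m \<omega>)\<^sup>2)) \<partial>M)
      \<le> (\<integral>\<^sup>+\<omega>. (\<Sum>r<3. ennreal (exp (\<Sum>m\<in>?L r. 3 * (?Z m \<omega>)\<^sup>2))) \<partial>M)"
    by (intro nn_integral_mono, subst sum_ennreal) (auto intro!: ennreal_leI exp_sum_mod_3_le)
  also have "\<dots> = (\<Sum>r<3. \<integral>\<^sup>+\<omega>. ennreal (exp (\<Sum>m\<in>?L r. 3 * (?Z m \<omega>)\<^sup>2)) \<partial>M)"
    by (rule nn_integral_sum) measurable
  also have "\<dots> \<le> (\<Sum>r<3::nat. 2 ^ N)"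
  proof (intro sum_mono)
    fix r :: nat
    have "(\<integral>\<^sup>+\<omega>. ennreal (exp (\<Sum>m\<in>?L r. 3 * (?Z m \<omega>)\<^sup>2)) \<partial>M) \<le> 2 ^ card (?L r)"
      unfolding scale
    proof (rule nn_integral_exp_disjoint_blocks_le)
      show "(\<Sum>k\<in>?K m. (norm (?c m k))\<^sup>2) \<le> 1 / 2" for m
        using c[of m] by (simp add: norm_mult power_mult_distrib sum_distrib_left[symmetric])
    qed (auto intro: disjoint_family_on_dyadic_blocks)
    also have "card (?L r) \<le> N"
      using card_mono[of "{..<N}" "?L r"] by auto
    hence "(2::ennreal) ^ card (?L r) \<le> 2 ^ N"
      by (intro power_increasing) auto
    finally show "(\<integral>\<^sup>+\<omega>. ennreal (exp (\<Sum>m\<in>?L r. 3 * (?Z m \<omega>)\<^sup>2)) \<partial>M) \<le> 2 ^ N" .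
  qed
  finally show ?thesis by simp
qed

section \<open>Almost sure bounds for the coefficients and on finite grids\<close>

lemma AE_summable_norm_\<xi>_sq:
  fixes w :: "nat \<Rightarrow> real"
  assumes "\<And>k. w k \<ge> 0" "summable w"
  shows "AE \<omega> in M. summable (\<lambda>k. w k * (norm (\<xi> k \<omega>))\<^sup>2)"
proof -
  have "(\<integral>\<^sup>+\<omega>. (\<Sum>k. ennreal (w k * (norm (\<xi> k \<omega>))\<^sup>2)) \<partial>M)
      = (\<Sum>k. \<integral>\<^sup>+\<omega>. ennreal (w k * (norm (\<xi> k \<omega>))\<^sup>2) \<partial>M)"
    by (rule nn_integral_suminf) measurable
  also have "\<dots> \<le> (\<Sum>k. ennreal (4 * w k))"
  proof (intro suminf_le summableI)
    fix k
    have "(\<integral>\<^sup>+\<omega>. ennreal (w k * (norm (\<xi> k \<omega>))\<^sup>2) \<partial>M) = ennreal (w k) * (\<integral>\<^sup>+\<omega>. ennreal ((norm (\<xi> k \<omega>))\<^sup>2) \<partial>M)"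
      using assms by (subst nn_integral_cmult[symmetric]) (auto simp: ennreal_mult)
    also have "\<dots> \<le> ennreal (w k) * 4"
      by (intro mult_left_mono nn_integral_norm_\<xi>_sq_le) auto
    finally show "(\<integral>\<^sup>+\<omega>. ennreal (w k * (norm (\<xi> k \<omega>))\<^sup>2) \<partial>M) \<le> ennreal (4 * w k)"
      using assms by (simp add: ennreal_mult mult.commute)
  qed
  also have "\<dots> < \<infinity>"
    using assms by (subst suminf_ennreal2) auto
  finally have "(\<integral>\<^sup>+\<omega>. (\<Sum>k. ennreal (w k * (norm (\<xi> k \<omega>))\<^sup>2)) \<partial>M) \<noteq> \<infinity>"
    by simp
  hence "AE \<omega> in M. (\<Sum>k. ennreal (w k * (norm (\<xi> k \<omega>))\<^sup>2)) \<noteq> \<infinity>"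
    by (intro nn_integral_PInf_AE) measurable
  thus ?thesis
    by eventually_elim (use assms in \<open>auto intro!: summable_suminf_not_top\<close>)
qed

text \<open>The weights \<open>1 / (k + 1)^2\<close> make a weighted sum of the
  \<open>|\<xi> k|^2\<close> converge almost surely, and the terms of a convergent series are
  bounded. Polynomial growth is all that the later Lipschitz estimate needs.\<close>

lemma AE_norm_\<xi>_linear_growth: "AE \<omega> in M. \<exists>C. \<forall>k. norm (\<xi> k \<omega>) \<le> C * (real k + 1)"
proof -
  have "summable (\<lambda>k. 1 / (real (k + 1))\<^sup>2)"
    using summable_ignore_initial_segment[OF inverse_power_summable[of 2, where 'a = real], of 1]
    unfolding inverse_eq_divide by simp
  hence "AE \<omega> in M. summable (\<lambda>k. 1 / (real (k + 1))\<^sup>2 * (norm (\<xi> k \<omega>))\<^sup>2)"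
    by (rule AE_summable_norm_\<xi>_sq[rotated]) simp
  thus ?thesis
  proof eventually_elim
    case (elim \<omega>)
    have "Bseq (\<lambda>k. 1 / (real (k + 1))\<^sup>2 * (norm (\<xi> k \<omega>))\<^sup>2)"
      by (rule convergent_imp_Bseq[OF convergentI[OF summable_LIMSEQ_zero[OF elim]]])
    then obtain C where C: "C > 0" "\<And>k. norm (1 / (real (k + 1))\<^sup>2 * (norm (\<xi> k \<omega>))\<^sup>2) \<le> C"
      unfolding Bseq_def by auto
    have "norm (\<xi> k \<omega>) \<le> sqrt C * (real k + 1)" for k
    proof (rule power2_le_imp_le)
      show "(norm (\<xi> k \<omega>))\<^sup>2 \<le> (sqrt C * (real k + 1))\<^sup>2"
        unfolding power_mult_distrib using C(1) C(2)[of k] by (simp add: divide_le_eq add.commute)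
    qed (use C(1) in auto)
    thus ?case by blast
  qed
qed

text \<open>The union bound is packed into a single random series \<open>W\<close> of weighted
  exponentials over all \<open>N\<close> and all grid points. Its mean is finite, so almost surely
  one finite value dominates every term, and taking logarithms gives growth linear in
  \<open>N\<close>.\<close>

lemma AE_grid_bound:
  fixes y :: "nat \<Rightarrow> nat \<Rightarrow> complex"
  assumes c: "\<And>m. (\<Sum>k\<in>{2 ^ m..<2 ^ (m + 3)}. (norm (c m k))\<^sup>2) \<le> 1 / 6"
    and y: "\<And>N j. norm (y N j) = 1"
  shows "AE \<omega> in M. \<exists>C. \<forall>N. \<forall>j<8 ^ (N + 3).
           (\<Sum>m<N. (norm (\<Sum>k\<in>{2 ^ m..<2 ^ (m + 3)}. c m k * \<xi> k \<omega> * y N j ^ k))\<^sup>2) \<le> C * (real N + 1)"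
proof -
  let ?S = "\<lambda>N j \<omega>. \<Sum>m<N. (norm (\<Sum>k\<in>{2 ^ m..<2 ^ (m + 3)}. c m k * \<xi> k \<omega> * y N j ^ k))\<^sup>2"
  \<comment> \<open>The weights \<open>32\<^sup>-\<^sup>N\<close> absorb the number \<open>8^(N+3)\<close> of grid points times the moment bound \<open>3 * 2^N\<close>.\<close>
  define W where "W \<omega> = (\<Sum>N. \<Sum>j<8 ^ (N + 3). ennreal ((1 / 32) ^ N) * ennreal (exp (?S N j \<omega>)))" for \<omega>
  have W_meas [measurable]: "W \<in> borel_measurable M"
    unfolding W_def by measurable
  \<comment> \<open>The factors \<open>y N j ^ k\<close> have modulus 1, so they join the
    coefficients without changing the variances.\<close>
  have int: "(\<integral>\<^sup>+\<omega>. ennreal (exp (?S N j \<omega>)) \<partial>M) \<le> 3 * 2 ^ N" for N j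
    using nn_integral_exp_dyadic_blocks_le[of "\<lambda>m k. c m k * y N j ^ k" N] c y
    by (simp add: norm_mult norm_power mult_ac)
  have "(\<integral>\<^sup>+\<omega>. W \<omega> \<partial>M) = (\<Sum>N. \<Sum>j<8 ^ (N + 3). ennreal ((1 / 32) ^ N) * (\<integral>\<^sup>+\<omega>. ennreal (exp (?S N j \<omega>)) \<partial>M))"
    unfolding W_def by (simp add: nn_integral_suminf nn_integral_sum nn_integral_cmult)
  also have "\<dots> \<le> (\<Sum>N. \<Sum>j<(8::nat) ^ (N + 3). ennreal ((1 / 32) ^ N) * (3 * 2 ^ N))"
    by (intro suminf_le sum_mono mult_left_mono int summableI) auto
  also have "\<dots> = (\<Sum>N. ennreal (1536 * (1 / 2) ^ N))"
  proof (intro suminf_cong)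
    fix N
    have "(\<Sum>j<(8::nat) ^ (N + 3). ennreal ((1 / 32) ^ N) * (3 * 2 ^ N))
        = ennreal (8 ^ (N + 3) * ((1 / 32) ^ N * (3 * 2 ^ N)))"
      by (simp add: ennreal_mult ennreal_power[symmetric] flip: ennreal_numeral)
    \<comment> \<open>\<open>1536 = 3 * 8 ^ 3\<close>, and the ratio of the geometric series is
      \<open>8 * 2 / 32 = 1 / 2\<close>.\<close>
    also have "(8 :: real) ^ (N + 3) * ((1 / 32) ^ N * (3 * 2 ^ N)) = 1536 * (8 * (1 / 32) * 2) ^ N"
      unfolding power_mult_distrib power_add by simp
    finally show "(\<Sum>j<(8::nat) ^ (N + 3). ennreal ((1 / 32) ^ N) * (3 * 2 ^ N)) = ennreal (1536 * (1 / 2) ^ N)"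
      by simp
  qed
  also have "\<dots> < \<infinity>"
    by (subst suminf_ennreal2) auto
  finally have "(\<integral>\<^sup>+\<omega>. W \<omega> \<partial>M) \<noteq> \<infinity>"
    by simp
  hence "AE \<omega> in M. W \<omega> \<noteq> \<infinity>"
    by (intro nn_integral_PInf_AE) auto
  thus ?thesis
  proof eventually_elim
    case (elim \<omega>)
    \<comment> \<open>The summand 1 makes \<open>v\<close> positive, so that its logarithm can be
      taken.\<close>
    define v where "v = enn2real (W \<omega>) + 1"
    have v: "v > 0" "W \<omega> \<le> ennreal v"
      using elim by (simp_all add: v_def add_nonneg_pos less_top)
    have "?S N j \<omega> \<le> (\<bar>ln v\<bar> + ln 32) * (real N + 1)" if j: "j < 8 ^ (N + 3)" for N j
    proof -
      have "ennreal ((1 / 32) ^ N * exp (?S N j \<omega>)) \<le> (\<Sum>j<8 ^ (N + 3). ennreal ((1 / 32) ^ N) * ennreal (exp (?S N j \<omega>)))"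
        by (subst ennreal_mult) (use j in \<open>auto intro!: member_le_sum\<close>)
      also have "\<dots> \<le> W \<omega>"
        unfolding W_def by (rule sum_le_suminf[of _ "{_}", simplified]) auto
      also note v(2)
      finally have "(1 / 32) ^ N * exp (?S N j \<omega>) \<le> v"
        using v(1) by (subst (asm) ennreal_le_iff) auto
      hence "exp (?S N j \<omega>) \<le> v * 32 ^ N"
        by (simp add: field_simps power_divide)
      hence "?S N j \<omega> \<le> ln (v * 32 ^ N)"
        using v(1) by (subst ln_ge_iff) auto
      also have "\<dots> = ln v + real N * ln 32"
        using v(1) by (simp add: ln_mult ln_realpow)
      also have "\<dots> \<le> (\<bar>ln v\<bar> + ln 32) * (real N + 1)"
      proof -
        have "0 \<le> \<bar>ln v\<bar> * real N" "0 \<le> ln (32 :: real)" "ln v \<le> \<bar>ln v\<bar>"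
          by auto
        thus ?thesis
          unfolding distrib_left distrib_right mult.commute[of "real N"] by linarith
      qed
      finally show ?thesis .
    qed
    thus ?case by blast
  qed
qed

end

section \<open>From grid points to the whole circle\<close>

lemma norm_cis_diff_le: "norm (cis s - cis t) \<le> \<bar>s - t\<bar>"
proof -
  have "cis s - cis t = cis t * (cis (s - t) - 1)"
    by (simp add: right_diff_distrib cis_mult)
  hence "norm (cis s - cis t) = 2 * \<bar>sin ((s - t) / 2)\<bar>"
    using dist_exp_i_1[of "s - t"] by (simp add: norm_mult cis_conv_exp)
  thus ?thesis
    using abs_sin_x_le_abs_x[of "(s - t) / 2"] by simp
qed

text \<open>The argument of \<open>x\<close> is rounded down to a multiple of
  \<open>2 * pi / L\<close>. A chord is no longer than its arc, and 7 is a rational bound for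
  \<open>2 * pi\<close>.\<close>

lemma circle_grid_approx:
  assumes "norm x = 1" "L > 0"
  obtains j where "j < L" "norm (x - cis (2 * pi * real j / real L)) \<le> 7 / real L"
proof -
  define t where "t = Arg2pi x"
  have t: "0 \<le> t" "t < 2 * pi" "x = cis t"
    using Arg2pi[of x] assms by (auto simp: t_def cis_conv_exp is_Arg_def)
  define j where "j = nat \<lfloor>t * real L / (2 * pi)\<rfloor>"
  have j: "real j \<le> t * real L / (2 * pi)" "t * real L / (2 * pi) < real j + 1"
    using t assms by (auto simp: j_def)
  have "t * real L / (2 * pi) < real L"
    using t assms by (simp add: field_simps)
  hence "j < L"
    using j by linarith
  moreover have "norm (x - cis (2 * pi * real j / real L)) \<le> 7 / real L"
  proof -
    have "norm (x - cis (2 * pi * real j / real L)) \<le> \<bar>t - 2 * pi * real j / real L\<bar>"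
      unfolding t(3) by (rule norm_cis_diff_le)
    also have "\<dots> \<le> 2 * pi / real L"
    proof -
      have "2 * pi * real j / real L \<le> t"
        using j assms by (simp add: field_simps)
      moreover have "t \<le> 2 * pi * real j / real L + 2 * pi / real L"
        unfolding add_divide_distrib[symmetric] using j assms by (simp add: field_simps)
      ultimately show ?thesis by linarith
    qed
    also have "\<dots> \<le> 7 / real L"
      using pi_less_4 pi_approx by (intro divide_right_mono) auto
    finally show ?thesis .
  qed
  ultimately show ?thesis by (rule that)
qed

text \<open>\<open>Y\<close> is controlled only through its partial sums. Summation by parts brings
  these in, and since \<open>b\<close> is decreasing they carry non-negative weights, so their
  bounds can be inserted.\<close>

lemma abel_summation_le:
  fixes b Y :: "nat \<Rightarrow> real"
  assumes "decseq b" "\<And>m. b m \<ge> 0" and Y: "\<And>N. (\<Sum>m<N. Y m) \<le> C * (real N + 1)"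
  shows "(\<Sum>m<N. b m * Y m) \<le> C * (b 0 + (\<Sum>m<N. b m))"
proof -
  have "(\<Sum>m<N. b m * Y m) = b N * (\<Sum>m<N. Y m) + (\<Sum>m<N. (b m - b (Suc m)) * (\<Sum>i<Suc m. Y i))"
    by (induction N) (simp_all add: algebra_simps)
  also have "\<dots> \<le> b N * (C * (real N + 1)) + (\<Sum>m<N. (b m - b (Suc m)) * (C * (real (Suc m) + 1)))"
    using decseq_SucD[OF assms(1)] assms(2)
    by (intro add_mono sum_mono mult_left_mono Y) auto
  \<comment> \<open>Summation by parts is undone for the extremal partial sums
    \<open>C * (N + 1)\<close>; the 1 in \<open>N + 1\<close> accounts for the term
    \<open>b 0\<close>.\<close>
  also have "\<dots> = C * (b 0 + (\<Sum>m<N. b m))"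
    by (induction N) (simp_all add: algebra_simps)
  finally show ?thesis .
qed

text \<open>Three quantities are each bounded by \<open>2 ^ (m + 3)\<close>: the number of terms,
  the growth \<open>k + 1\<close> of a coefficient, and the Lipschitz constant \<open>k\<close> of
  the \<open>k\<close>-th power on the circle. Their product \<open>8 ^ (m + 3)\<close> dictates the
  size of the grid.\<close>

lemma dyadic_block_lipschitz:
  fixes c :: "nat \<Rightarrow> complex"
  assumes c: "\<And>k. norm (c k) \<le> C * (real k + 1)" and "norm x = 1" "norm y = 1"
  shows "norm ((\<Sum>k\<in>{2 ^ m..<2 ^ (m + 3)}. c k * x ^ k) - (\<Sum>k\<in>{2 ^ m..<2 ^ (m + 3)}. c k * y ^ k))
           \<le> C * 8 ^ (m + 3) * norm (x - y)"
proof -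
  let ?K = "{2 ^ m..<2 ^ (m + 3)} :: nat set"
  let ?D = "2 ^ (m + 3) :: real"
  have "C \<ge> 0"
    using order.trans[OF norm_ge_zero c[of 0]] by simp
  have term_le: "norm (c k * (x ^ k - y ^ k)) \<le> C * ?D * (?D * norm (x - y))" if "k \<in> ?K" for k
  proof -
    have "real (k + 1) \<le> real (2 ^ (m + 3))"
      using that by (intro of_nat_mono) auto
    hence k: "real k + 1 \<le> ?D" by simp
    have "norm (c k) \<le> C * ?D"
      using c[of k] mult_left_mono[OF k \<open>C \<ge> 0\<close>] by linarith
    moreover have "norm (x ^ k - y ^ k) \<le> ?D * norm (x - y)"
    proof -
      have "norm (x ^ k - y ^ k) \<le> real k * norm (x - y)"
        using assms by (intro norm_power_diff) auto
      also have "\<dots> \<le> ?D * norm (x - y)"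
        using k by (intro mult_right_mono norm_ge_zero) linarith
      finally show ?thesis .
    qed
    ultimately show ?thesis
      unfolding norm_mult by (intro mult_mono) (use \<open>C \<ge> 0\<close> in auto)
  qed
  have "norm ((\<Sum>k\<in>?K. c k * x ^ k) - (\<Sum>k\<in>?K. c k * y ^ k)) = norm (\<Sum>k\<in>?K. c k * (x ^ k - y ^ k))"
    by (simp add: sum_subtractf right_diff_distrib)
  also have "\<dots> \<le> real (card ?K) * (C * ?D * (?D * norm (x - y)))"
    using term_le by (intro order.trans[OF norm_sum] sum_bounded_above) auto
  also have "\<dots> \<le> ?D * (C * ?D * (?D * norm (x - y)))"
  proof (intro mult_right_mono)
    have "card ?K \<le> 2 ^ (m + 3)" by simp
    thus "real (card ?K) \<le> ?D"
      by (metis of_nat_le_iff of_nat_numeral of_nat_power)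
  qed (use \<open>C \<ge> 0\<close> in auto)
  also have "\<dots> = C * (?D * ?D * ?D) * norm (x - y)"
    by (simp only: mult_ac)
  also have "?D * ?D * ?D = 8 ^ (m + 3)"
    by (simp flip: power_mult_distrib)
  finally show ?thesis .
qed

context gaussian_sequence
begin

text \<open>For a given \<open>N\<close>, the grid of \<open>8 ^ (N + 3)\<close> points is so fine
  that each block with \<open>m < N\<close> changes by at most the constant \<open>7 * A\<close>
  between \<open>x\<close> and a nearby grid point. The squared errors then add up to a multiple of
  \<open>N\<close>, which the linear bound tolerates.\<close>

lemma AE_uniform_bound:
  assumes c: "\<And>m. (\<Sum>k\<in>{2 ^ m..<2 ^ (m + 3)}. (norm (c m k))\<^sup>2) \<le> 1 / 6"
  shows "AE \<omega> in M. \<exists>C. \<forall>x N. norm x = 1 \<longrightarrow>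
           (\<Sum>m<N. (norm (\<Sum>k\<in>{2 ^ m..<2 ^ (m + 3)}. c m k * \<xi> k \<omega> * x ^ k))\<^sup>2) \<le> C * (real N + 1)"
proof -
  let ?K = "\<lambda>m::nat. {2 ^ m..<2 ^ (m + 3)} :: nat set"
  let ?Z = "\<lambda>\<omega> m x. \<Sum>k\<in>?K m. c m k * \<xi> k \<omega> * x ^ k"
  let ?y = "\<lambda>N j. cis (2 * pi * real j / real (8 ^ (N + 3)))"
  have "AE \<omega> in M. \<exists>C. \<forall>N. \<forall>j<8 ^ (N + 3). (\<Sum>m<N. (norm (?Z \<omega> m (?y N j)))\<^sup>2) \<le> C * (real N + 1)"
    by (rule AE_grid_bound[OF c]) simp
  with AE_norm_\<xi>_linear_growth show ?thesis
  proof eventually_elim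
    case (elim \<omega>)
    from elim obtain A where A: "\<And>k. norm (\<xi> k \<omega>) \<le> A * (real k + 1)" by blast
    from elim obtain B where B: "\<And>N j. j < 8 ^ (N + 3) \<Longrightarrow> (\<Sum>m<N. (norm (?Z \<omega> m (?y N j)))\<^sup>2) \<le> B * (real N + 1)"
      by blast
    have "A \<ge> 0"
      using order.trans[OF norm_ge_zero A[of 0]] by simp
    \<comment> \<open>The Lipschitz estimate asks for a bound at every \<open>k\<close>, while
      \<open>c m k\<close> is controlled only inside its block; outside it is replaced by 0.\<close>
    define c' where "c' m k = (if k \<in> ?K m then c m k else 0) * \<xi> k \<omega>" for m k
    have c'_le: "norm (c' m k) \<le> A * (real k + 1)" for m k
    proof (cases "k \<in> ?K m")
      case True
      have "(norm (c m k))\<^sup>2 \<le> 1\<^sup>2"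
        using member_le_sum[of k "?K m" "\<lambda>k. (norm (c m k))\<^sup>2"] True c[of m] by auto
      hence "norm (c m k) \<le> 1"
        by (rule power2_le_imp_le) auto
      thus ?thesis
        using True A[of k] mult_right_mono[of "norm (c m k)" 1 "norm (\<xi> k \<omega>)"]
        by (auto simp: c'_def norm_mult)
    qed (use \<open>A \<ge> 0\<close> in \<open>auto simp: c'_def\<close>)
    have Z_eq: "?Z \<omega> m x = (\<Sum>k\<in>?K m. c' m k * x ^ k)" for m x
      by (intro sum.cong) (auto simp: c'_def)
    have "(\<Sum>m<N. (norm (?Z \<omega> m x))\<^sup>2) \<le> (2 * B + 2 * (7 * A)\<^sup>2) * (real N + 1)" if x: "norm x = 1" for x N
    proof -
      obtain j where j: "j < 8 ^ (N + 3)" "norm (x - ?y N j) \<le> 7 / real (8 ^ (N + 3))"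
        using circle_grid_approx[OF x, of "8 ^ (N + 3)"] by auto
      have term_le: "(norm (?Z \<omega> m x))\<^sup>2 \<le> 2 * (norm (?Z \<omega> m (?y N j)))\<^sup>2 + 2 * (7 * A)\<^sup>2" if "m < N" for m
      proof -
        have "norm (?Z \<omega> m x - ?Z \<omega> m (?y N j)) \<le> A * 8 ^ (m + 3) * norm (x - ?y N j)"
          unfolding Z_eq using c'_le x by (intro dyadic_block_lipschitz) auto
        also have "\<dots> \<le> A * 8 ^ (N + 3) * (7 / real (8 ^ (N + 3)))"
          using that \<open>A \<ge> 0\<close> by (intro mult_mono j power_increasing) auto
        also have "\<dots> = 7 * A" by simp
        finally have "norm (?Z \<omega> m x) \<le> norm (?Z \<omega> m (?y N j)) + 7 * A"
          using norm_triangle_sub[of "?Z \<omega> m x" "?Z \<omega> m (?y N j)"] by linarith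
        hence "(norm (?Z \<omega> m x))\<^sup>2 \<le> (norm (?Z \<omega> m (?y N j)) + 7 * A)\<^sup>2"
          by (intro power_mono) auto
        also have "\<dots> \<le> 2 * (norm (?Z \<omega> m (?y N j)))\<^sup>2 + 2 * (7 * A)\<^sup>2"
          using sum_squares_bound[of "norm (?Z \<omega> m (?y N j))" "7 * A"] by (simp add: power2_sum)
        finally show ?thesis .
      qed
      have "(\<Sum>m<N. (norm (?Z \<omega> m x))\<^sup>2) \<le> (\<Sum>m<N. 2 * (norm (?Z \<omega> m (?y N j)))\<^sup>2 + 2 * (7 * A)\<^sup>2)"
        by (intro sum_mono term_le) auto
      also have "\<dots> = 2 * (\<Sum>m<N. (norm (?Z \<omega> m (?y N j)))\<^sup>2) + real N * (2 * (7 * A)\<^sup>2)"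
        by (simp add: sum.distrib sum_distrib_left)
      also have "\<dots> \<le> 2 * (B * (real N + 1)) + (real N + 1) * (2 * (7 * A)\<^sup>2)"
        by (intro add_mono mult_left_mono mult_right_mono B j) auto
      also have "\<dots> = (2 * B + 2 * (7 * A)\<^sup>2) * (real N + 1)"
        by (simp add: algebra_simps)
      finally show ?thesis .
    qed
    thus ?case by blast
  qed
qed

text \<open>The linear bound says that the squares are bounded on average over \<open>m\<close>;
  against decreasing summable weights this is as good as a bound on each square. The constant
  depends on the sample point but not on \<open>x\<close> or \<open>N\<close>.\<close>

lemma AE_weighted_square_sum_bound:
  assumes c: "\<And>m. (\<Sum>k\<in>{2 ^ m..<2 ^ (m + 3)}. (norm (c m k))\<^sup>2) \<le> 1 / 6"
    and b: "decseq b" "\<And>m. b m \<ge> 0" "summable b"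
  shows "AE \<omega> in M. \<exists>C. \<forall>x N. norm x = 1 \<longrightarrow>
           (\<Sum>m<N. b m * (norm (\<Sum>k\<in>{2 ^ m..<2 ^ (m + 3)}. c m k * \<xi> k \<omega> * x ^ k))\<^sup>2) \<le> C"
  using AE_uniform_bound[OF c]
proof eventually_elim
  case (elim \<omega>)
  let ?Z = "\<lambda>m x. \<Sum>k\<in>{2 ^ m..<2 ^ (m + 3)}. c m k * \<xi> k \<omega> * x ^ k"
  from elim obtain C where C: "\<And>x N. norm x = 1 \<Longrightarrow> (\<Sum>m<N. (norm (?Z m x))\<^sup>2) \<le> C * (real N + 1)"
    by blast
  have "C \<ge> 0"
    using C[of 1 0] by simp
  have "(\<Sum>m<N. b m * (norm (?Z m x))\<^sup>2) \<le> C * (b 0 + suminf b)" if "norm x = 1" for x N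
  proof -
    have "(\<Sum>m<N. b m * (norm (?Z m x))\<^sup>2) \<le> C * (b 0 + (\<Sum>m<N. b m))"
      by (rule abel_summation_le[OF b(1,2) C[OF that]])
    also have "\<dots> \<le> C * (b 0 + suminf b)"
      using b \<open>C \<ge> 0\<close> by (intro mult_left_mono add_left_mono sum_le_suminf) auto
    finally show ?thesis .
  qed
  thus ?case by blast
qed

end

section \<open>Power series in the disk\<close>

lemma has_bochner_integral_cis:
  "has_bochner_integral lborel (\<lambda>t. indicator {0..2 * pi} t *\<^sub>R cis (of_int k * t))
     (if k = 0 then of_real (2 * pi) else 0)"
proof (cases "k = 0")
  case True
  have "has_bochner_integral lborel (\<lambda>t. indicator {0..2 * pi} t *\<^sub>R (1::complex)) (of_real (2 * pi) - of_real 0)"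
    by (rule has_bochner_integral_FTC_Icc) (auto intro!: derivative_eq_intros)
  thus ?thesis using True by simp
next
  case False
  have "has_bochner_integral lborel (\<lambda>t. indicator {0..2 * pi} t *\<^sub>R cis (of_int k * t))
          (cis (of_int k * (2 * pi)) / (\<i> * of_int k) - cis (of_int k * 0) / (\<i> * of_int k))"
  proof (rule has_bochner_integral_FTC_Icc)
    show "((\<lambda>t. cis (of_int k * t) / (\<i> * of_int k)) has_vector_derivative cis (of_int k * t)) (at t within {0..2 * pi})" for t
    proof -
      have "((\<lambda>z. exp (\<i> * (of_int k * z)) / (\<i> * of_int k)) has_field_derivative
          exp (\<i> * (of_int k * of_real t))) (at (of_real t))"
        using False by (auto intro!: derivative_eq_intros simp: field_simps)
      from has_vector_derivative_real_field[OF this] show ?thesis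
        by (simp add: cis_conv_exp)
    qed
  qed (auto intro!: continuous_intros)
  moreover have "cis (of_int k * (2 * pi)) = 1"
    using cis_multiple_2pi[of "of_int k"] by (simp add: mult_ac)
  ultimately show ?thesis using False by simp
qed

text \<open>The frequency map \<open>g\<close> need not be injective, so that both uses are covered:
  frequencies \<open>j - k\<close> for Fourier coefficients, and \<open>m - n\<close> over pairs for
  Parseval's identity.\<close>

lemma has_bochner_integral_trig_polynomial:
  assumes "finite J"
  shows "has_bochner_integral lborel
           (\<lambda>t. indicator {0..2 * pi} t *\<^sub>R (\<Sum>j\<in>J. \<alpha> j * cis (of_int (g j) * t)))
           (of_real (2 * pi) * (\<Sum>j\<in>J. if g j = 0 then \<alpha> j else 0))"
proof -
  have "has_bochner_integral lborel
      (\<lambda>t. \<Sum>j\<in>J. \<alpha> j * (indicator {0..2 * pi} t *\<^sub>R cis (of_int (g j) * t)))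
      (\<Sum>j\<in>J. \<alpha> j * (if g j = 0 then of_real (2 * pi) else 0))"
    by (intro has_bochner_integral_sum has_bochner_integral_mult_right has_bochner_integral_cis)
  moreover have "(\<Sum>j\<in>J. \<alpha> j * (if g j = 0 then of_real (2 * pi) else 0))
      = of_real (2 * pi) * (\<Sum>j\<in>J. if g j = 0 then \<alpha> j else 0)"
    unfolding sum_distrib_left by (intro sum.cong) auto
  ultimately show ?thesis
    by (simp add: scaleR_sum_right)
qed

lemma fourier_coeff_laurent_polynomial:
  assumes "finite J" and f: "\<And>t. f (cis t) = (\<Sum>j\<in>J. \<alpha> j * cis t powi j)"
  shows "fourier_coeff f k = (if k \<in> J then \<alpha> k else 0)"
proof -
  have "f (cis t) * cis (- (of_int k * t)) = (\<Sum>j\<in>J. \<alpha> j * cis (of_int (j - k) * t))" for t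
    unfolding f by (simp add: sum_distrib_right cis_power_int mult.assoc cis_mult left_diff_distrib)
  moreover have "(LBINT t:{0..2 * pi}. \<Sum>j\<in>J. \<alpha> j * cis (of_int (j - k) * t))
      = of_real (2 * pi) * (\<Sum>j\<in>J. if j - k = 0 then \<alpha> j else 0)"
    unfolding set_lebesgue_integral_def
    by (rule has_bochner_integral_integral_eq[OF has_bochner_integral_trig_polynomial[OF assms(1)]])
  ultimately show ?thesis
    using assms(1) by (simp add: fourier_coeff_def)
qed

text \<open>Parseval's identity: in the double sum for \<open>p * cnj p\<close> only the diagonal
  has frequency 0.\<close>

lemma nn_integral_norm_sq_polynomial:
  "(\<integral>\<^sup>+t\<in>{0..2 * pi}. ennreal ((norm (\<Sum>n<N. c n * cis t ^ n))\<^sup>2) \<partial>lborel)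
     = ennreal (2 * pi * (\<Sum>n<N. (norm (c n))\<^sup>2))"
proof -
  let ?p = "\<lambda>t. \<Sum>n<N. c n * cis t ^ n"
  have eq: "of_real ((norm (?p t))\<^sup>2)
      = (\<Sum>(m, n)\<in>{..<N} \<times> {..<N}. c m * cnj (c n) * cis (of_int (int m - int n) * t))" for t
  proof -
    have "of_real ((norm (?p t))\<^sup>2) = ?p t * cnj (?p t)"
      by (rule complex_norm_square)
    also have "\<dots> = (\<Sum>m<N. \<Sum>n<N. (c m * cis t ^ m) * (cnj (c n) * cnj (cis t ^ n)))"
      by (simp add: sum_product)
    also have "\<dots> = (\<Sum>(m, n)\<in>{..<N} \<times> {..<N}. c m * cnj (c n) * cis (of_int (int m - int n) * t))"
    proof -
      have "cis t ^ m * cnj (cis t ^ n) = cis (of_int (int m - int n) * t)" for m n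
        unfolding Complex.DeMoivre cis_cnj cis_mult by (simp add: left_diff_distrib)
      hence "(c m * cis t ^ m) * (cnj (c n) * cnj (cis t ^ n))
          = c m * cnj (c n) * cis (of_int (int m - int n) * t)" for m n
        by (metis (no_types, lifting) mult.assoc mult.left_commute)
      thus ?thesis
        by (simp only: sum.cartesian_product)
    qed
    finally show ?thesis .
  qed
  have "has_bochner_integral lborel
      (\<lambda>t. indicator {0..2 * pi} t *\<^sub>R (\<Sum>p\<in>{..<N} \<times> {..<N}. (c (fst p) * cnj (c (snd p))) * cis (of_int (int (fst p) - int (snd p)) * t)))
      (of_real (2 * pi) * (\<Sum>p\<in>{..<N} \<times> {..<N}. if int (fst p) - int (snd p) = 0 then c (fst p) * cnj (c (snd p)) else 0))"
    by (rule has_bochner_integral_trig_polynomial) auto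
  moreover have "(\<Sum>p\<in>{..<N} \<times> {..<N}. if int (fst p) - int (snd p) = 0 then c (fst p) * cnj (c (snd p)) else 0)
      = of_real (\<Sum>n<N. (norm (c n))\<^sup>2)"
  proof -
    have "(\<Sum>p\<in>{..<N} \<times> {..<N}. if int (fst p) - int (snd p) = 0 then c (fst p) * cnj (c (snd p)) else 0)
        = (\<Sum>m<N. \<Sum>n<N. if m = n then c m * cnj (c n) else 0)"
      by (simp only: sum.cartesian_product case_prod_unfold) simp
    also have "\<dots> = of_real (\<Sum>n<N. (norm (c n))\<^sup>2)"
      by (simp add: sum.delta complex_norm_square del: of_real_power)
    finally show ?thesis .
  qed
  ultimately have "has_bochner_integral lborel
      (\<lambda>t. complex_of_real (indicator {0..2 * pi} t * (norm (?p t))\<^sup>2)) (of_real (2 * pi * (\<Sum>n<N. (norm (c n))\<^sup>2)))"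
    using eq by (simp add: scaleR_conv_of_real case_prod_unfold)
  hence "has_bochner_integral lborel
      (\<lambda>t. indicator {0..2 * pi} t * (norm (?p t))\<^sup>2) (2 * pi * (\<Sum>n<N. (norm (c n))\<^sup>2))"
    using has_bochner_integral_Re[of lborel "\<lambda>t. complex_of_real (indicator {0..2 * pi} t * (norm (?p t))\<^sup>2)"] by force
  hence "(\<integral>\<^sup>+t. ennreal (indicator {0..2 * pi} t * (norm (?p t))\<^sup>2) \<partial>lborel) = ennreal (2 * pi * (\<Sum>n<N. (norm (c n))\<^sup>2))"
    by (intro nn_integral_eq_integral[THEN trans]) (auto simp: has_bochner_integral_iff)
  thus ?thesis
    by (simp add: ennreal_mult' ennreal_indicator mult.commute)
qed

text \<open>Parseval bounds the partial sums in the square mean on each circle of radius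
  \<open>r < 1\<close>, Fatou's lemma passes to \<open>F\<close>, and \<open>u \<le> 1 + u^2\<close>
  leads from the square mean to the mean.\<close>

lemma hardy1_norm_power_series_le:
  fixes c :: "nat \<Rightarrow> complex"
  assumes c: "summable (\<lambda>n. (norm (c n))\<^sup>2)" and F: "\<And>z. z \<in> ball 0 1 \<Longrightarrow> (\<lambda>n. c n * z ^ n) sums F z"
  shows "hardy1_norm F \<le> ennreal (1 + (\<Sum>n. (norm (c n))\<^sup>2))"
  unfolding hardy1_norm_def
proof (rule SUP_least)
  fix r :: real assume r: "r \<in> {0..<1}"
  let ?z = "\<lambda>t. of_real r * cis t :: complex"
  let ?p = "\<lambda>N t. \<Sum>n<N. c n * ?z t ^ n"
  let ?S = "\<Sum>n. (norm (c n))\<^sup>2"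
  have lim: "(\<lambda>N. ?p N t) \<longlonglongrightarrow> F (?z t)" for t
    using F[of "?z t"] r by (simp add: sums_def norm_mult)
  have p_int: "(\<integral>\<^sup>+t. ennreal ((norm (?p N t))\<^sup>2) * indicator {0..2 * pi} t \<partial>lborel) \<le> ennreal (2 * pi * ?S)" for N
  proof -
    have "(norm (c n * of_real r ^ n))\<^sup>2 \<le> (norm (c n))\<^sup>2" for n
      using r by (intro power_mono) (auto simp: norm_mult norm_power intro!: mult_left_le power_le_one)
    hence "(\<Sum>n<N. (norm (c n * of_real r ^ n))\<^sup>2) \<le> (\<Sum>n<N. (norm (c n))\<^sup>2)"
      by (rule sum_mono)
    also have "\<dots> \<le> ?S"
      by (intro sum_le_suminf c) auto
    finally show ?thesis
      using nn_integral_norm_sq_polynomial[where c = "\<lambda>n. c n * of_real r ^ n" and N = N]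
      by (simp add: power_mult_distrib mult.assoc ennreal_leI)
  qed
  have [measurable]: "(\<lambda>t. ?p N t) \<in> borel_measurable borel" for N
    by (intro borel_measurable_continuous_onI continuous_intros)
  have "(\<integral>\<^sup>+t. ennreal ((norm (F (?z t)))\<^sup>2) * indicator {0..2 * pi} t \<partial>lborel)
      = (\<integral>\<^sup>+t. liminf (\<lambda>N. ennreal ((norm (?p N t))\<^sup>2) * indicator {0..2 * pi} t) \<partial>lborel)"
  proof (intro nn_integral_cong lim_imp_Liminf[symmetric])
    fix t
    have "(\<lambda>N. ennreal ((norm (?p N t))\<^sup>2)) \<longlonglongrightarrow> ennreal ((norm (F (?z t)))\<^sup>2)"
      by (intro tendsto_ennrealI tendsto_power tendsto_norm lim)
    thus "(\<lambda>N. ennreal ((norm (?p N t))\<^sup>2) * indicator {0..2 * pi} t) \<longlonglongrightarrow> ennreal ((norm (F (?z t)))\<^sup>2) * indicator {0..2 * pi} t"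
      by (auto simp: indicator_def)
  qed auto
  also have "\<dots> \<le> liminf (\<lambda>N. \<integral>\<^sup>+t. ennreal ((norm (?p N t))\<^sup>2) * indicator {0..2 * pi} t \<partial>lborel)"
    by (rule nn_integral_liminf) measurable
  also have "\<dots> \<le> ennreal (2 * pi * ?S)"
    by (intro Liminf_le always_eventually allI p_int) auto
  finally have F_sq: "(\<integral>\<^sup>+t. ennreal ((norm (F (?z t)))\<^sup>2) * indicator {0..2 * pi} t \<partial>lborel) \<le> ennreal (2 * pi * ?S)" .
  \<comment> \<open>On this circle \<open>F\<close> is a pointwise limit of polynomials, which
    provides its measurability.\<close>
  have [measurable]: "(\<lambda>t. F (?z t)) \<in> borel_measurable borel"
    by (rule borel_measurable_LIMSEQ_metric[OF _ lim]) measurable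
  have "(\<integral>\<^sup>+t\<in>{0..2 * pi}. ennreal (norm (F (?z t)) / (2 * pi)) \<partial>lborel)
      \<le> (\<integral>\<^sup>+t. ennreal (1 / (2 * pi)) * (indicator {0..2 * pi} t + ennreal ((norm (F (?z t)))\<^sup>2) * indicator {0..2 * pi} t) \<partial>lborel)"
  proof (intro nn_integral_mono)
    fix t
    have "norm (F (?z t)) \<le> 1 + (norm (F (?z t)))\<^sup>2"
      using sum_squares_bound[of 1 "norm (F (?z t))"] norm_ge_zero[of "F (?z t)"]
      unfolding power_one mult_1_right by linarith
    hence "norm (F (?z t)) / (2 * pi) \<le> 1 / (2 * pi) * (1 + (norm (F (?z t)))\<^sup>2)"
      by (simp add: divide_right_mono)
    hence "ennreal (norm (F (?z t)) / (2 * pi)) \<le> ennreal (1 / (2 * pi)) * (1 + ennreal ((norm (F (?z t)))\<^sup>2))"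
      by (simp add: ennreal_leI flip: ennreal_mult ennreal_plus ennreal_1)
    thus "ennreal (norm (F (?z t)) / (2 * pi)) * indicator {0..2 * pi} t
        \<le> ennreal (1 / (2 * pi)) * (indicator {0..2 * pi} t + ennreal ((norm (F (?z t)))\<^sup>2) * indicator {0..2 * pi} t)"
      by (auto simp: indicator_def)
  qed
  also have "\<dots> = ennreal (1 / (2 * pi)) * (ennreal (2 * pi) + (\<integral>\<^sup>+t. ennreal ((norm (F (?z t)))\<^sup>2) * indicator {0..2 * pi} t \<partial>lborel))"
    by (subst nn_integral_cmult, measurable, subst nn_integral_add) auto
  also have "\<dots> \<le> ennreal (1 / (2 * pi)) * (ennreal (2 * pi) + ennreal (2 * pi * ?S))"
    by (intro mult_left_mono add_left_mono F_sq) auto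
  also have "\<dots> = ennreal (1 / (2 * pi) * (2 * pi + 2 * pi * ?S))"
    using suminf_nonneg[OF c] by (simp flip: ennreal_mult ennreal_plus)
  also have "1 / (2 * pi) * (2 * pi + 2 * pi * ?S) = 1 + ?S"
    by (simp add: field_simps)
  finally show "(\<integral>\<^sup>+t\<in>{0..2 * pi}. ennreal (norm (F (?z t)) / (2 * pi)) \<partial>lborel) \<le> ennreal (1 + ?S)" .
qed

lemma hardy1_power_series:
  fixes c :: "nat \<Rightarrow> complex"
  assumes "summable (\<lambda>n. (norm (c n))\<^sup>2)" and F: "\<And>z. z \<in> ball 0 1 \<Longrightarrow> (\<lambda>n. c n * z ^ n) sums F z"
  shows "F \<in> hardy1"
proof -
  have "F holomorphic_on ball 0 1"
    by (rule power_series_holomorphic[of 0 1 c]) (use F in simp)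
  moreover have "hardy1_norm F < \<infinity>"
    by (rule order.strict_trans1[OF hardy1_norm_power_series_le[OF assms]]) auto
  ultimately show ?thesis
    by (simp add: hardy1_def)
qed

section \<open>Taylor coefficients and convergence in the disk\<close>

lemma taylor_coeff_power_series:
  assumes F: "\<And>z. z \<in> ball 0 1 \<Longrightarrow> (\<lambda>n. c n * z ^ n) sums F z"
  shows "taylor_coeff F (int n) = c n"
proof -
  have "eventually (\<lambda>z. z \<in> ball (0::complex) 1) (nhds 0)"
    by (intro eventually_nhds_in_open) auto
  hence "F has_fps_expansion Abs_fps c"
    by (intro has_fps_expansionI, eventually_elim) (use F in simp)
  from fps_nth_fps_expansion[OF this, of n] show ?thesis
    by (simp add: taylor_coeff_def)
qed

lemma summable_power_series_ball:
  fixes c :: "nat \<Rightarrow> complex"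
  assumes "summable (\<lambda>n. (norm (c n))\<^sup>2)" "z \<in> ball 0 1"
  shows "summable (\<lambda>n. c n * z ^ n)"
proof (rule summable_comparison_test)
  show "summable (\<lambda>n. (norm (c n))\<^sup>2 + (norm z ^ 2) ^ n)"
    using assms by (intro summable_add summable_geometric) (auto simp: power_less_one_iff)
  have "norm (c n * z ^ n) \<le> (norm (c n))\<^sup>2 + (norm z ^ 2) ^ n" for n
  proof -
    have "2 * norm (c n) * norm z ^ n \<le> (norm (c n))\<^sup>2 + (norm z ^ n)\<^sup>2"
      by (rule sum_squares_bound)
    moreover have "0 \<le> norm (c n) * norm z ^ n"
      by simp
    ultimately show ?thesis
      unfolding norm_mult norm_power power_commutes power_mult[symmetric] mult.commute[of 2] by linarith
  qed
  thus "\<exists>N. \<forall>n\<ge>N. norm (c n * z ^ n) \<le> (norm (c n))\<^sup>2 + (norm z ^ 2) ^ n"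
    by blast
qed

section \<open>Trapezoidal kernels and the Sledd seminorm\<close>

text \<open>The tent function of half-width \<open>m\<close>, where \<open>m\<close> stands for
  \<open>N + 1\<close> in the Fejer kernel of degree \<open>N\<close>. The truncation at 0 allows
  kernels of different degrees to be written over one common range of frequencies.\<close>

definition fejer_coeff :: "real \<Rightarrow> int \<Rightarrow> real" where
  "fejer_coeff m k = max 0 (1 - real_of_int \<bar>k\<bar> / m)"

lemma fejer_kernel_eq_sum:
  assumes "N \<le> R"
  shows "fejer_kernel N z = (\<Sum>k\<in>{- int R..int R}. of_real (fejer_coeff (real N + 1) k) * z powi k)"
  unfolding fejer_kernel_def
proof (intro sum.mono_neutral_cong_left ballI)
  show "{- int N..int N} \<subseteq> {- int R..int R}"
    using assms by auto
  show "of_real (fejer_coeff (real N + 1) k) * z powi k = 0" if "k \<in> {- int R..int R} - {- int N..int N}" for k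
  proof -
    have "int N + 1 \<le> \<bar>k\<bar>"
      using that by auto
    hence "real N + 1 \<le> real_of_int \<bar>k\<bar>"
      by linarith
    thus ?thesis
      by (simp add: fejer_coeff_def field_simps)
  qed
  show "of_real (1 - real_of_int \<bar>k\<bar> / (real N + 1)) * z powi k
      = of_real (fejer_coeff (real N + 1) k) * z powi k" if "k \<in> {- int N..int N}" for k
  proof -
    have "\<bar>k\<bar> \<le> int N"
      using that by auto
    hence "real_of_int \<bar>k\<bar> \<le> real N + 1"
      by linarith
    thus ?thesis
      by (simp add: fejer_coeff_def field_simps)
  qed
qed auto

text \<open>The index is shifted: these are the coefficients of \<^term>\<open>trapezoidal_kernel (Suc m)\<close>.\<close>

definition trapezoidal_coeff :: "nat \<Rightarrow> int \<Rightarrow> real" where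
  "trapezoidal_coeff m k = 2 * fejer_coeff (2 ^ (m + 3)) k - fejer_coeff (2 ^ (m + 2)) k
     + fejer_coeff (2 ^ m) k - 2 * fejer_coeff (2 ^ (m + 1)) k"

lemma fejer_coeff_eq_0: "m > 0 \<Longrightarrow> m \<le> real_of_int \<bar>k\<bar> \<Longrightarrow> fejer_coeff m k = 0"
  by (simp add: fejer_coeff_def field_simps)

lemma fejer_coeff_eq: "m > 0 \<Longrightarrow> real_of_int \<bar>k\<bar> \<le> m \<Longrightarrow> fejer_coeff m k = 1 - real_of_int \<bar>k\<bar> / m"
  by (simp add: fejer_coeff_def field_simps)

lemma fejer_coeff_bounds: "m > 0 \<Longrightarrow> 0 \<le> fejer_coeff m k \<and> fejer_coeff m k \<le> 1"
  by (simp add: fejer_coeff_def)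

text \<open>The triangle inequality with the weights 2, 1, 1, 2; only boundedness independent of
  \<open>m\<close> matters.\<close>

lemma abs_trapezoidal_coeff_le: "\<bar>trapezoidal_coeff m k\<bar> \<le> 6"
  using fejer_coeff_bounds[of "2 ^ (m + 3)" k] fejer_coeff_bounds[of "2 ^ (m + 2)" k]
    fejer_coeff_bounds[of "2 ^ m" k] fejer_coeff_bounds[of "2 ^ (m + 1)" k]
  unfolding trapezoidal_coeff_def by auto

lemma trapezoidal_coeff_eq_0_high:
  assumes "2 ^ (m + 3) \<le> \<bar>k\<bar>"
  shows "trapezoidal_coeff m k = 0"
proof -
  have k: "2 ^ (m + 3) \<le> real_of_int \<bar>k\<bar>"
    using assms by (metis of_int_le_iff of_int_numeral of_int_power)
  have "fejer_coeff (2 ^ j) k = 0" if "j \<le> m + 3" for j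
    using order.trans[OF power_increasing[OF that, of "2 :: real"] k] by (intro fejer_coeff_eq_0) auto
  from this[of m] this[of "m + 1"] this[of "m + 2"] this[of "m + 3"] show ?thesis
    unfolding trapezoidal_coeff_def by simp
qed

text \<open>Below \<open>2 ^ m\<close> all four Fejer coefficients are affine in the frequency, and the weights
  \<open>2, -1, 1, -2\<close> are chosen so that both the constants and the slopes cancel.\<close>

lemma trapezoidal_coeff_eq_0_low:
  assumes "\<bar>k\<bar> \<le> 2 ^ m"
  shows "trapezoidal_coeff m k = 0"
proof -
  have k: "real_of_int \<bar>k\<bar> \<le> 2 ^ m"
    using assms by (metis of_int_le_iff of_int_numeral of_int_power)
  have "fejer_coeff (2 ^ j) k = 1 - real_of_int \<bar>k\<bar> / 2 ^ j" if "m \<le> j" for j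
    using order.trans[OF k power_increasing[OF that, of "2 :: real"]] by (intro fejer_coeff_eq) auto
  hence "trapezoidal_coeff m k = 2 * (1 - real_of_int \<bar>k\<bar> / 2 ^ (m + 3)) - (1 - real_of_int \<bar>k\<bar> / 2 ^ (m + 2))
      + (1 - real_of_int \<bar>k\<bar> / 2 ^ m) - 2 * (1 - real_of_int \<bar>k\<bar> / 2 ^ (m + 1))"
    unfolding trapezoidal_coeff_def by (simp only: le_add1 order_refl)
  also have "\<dots> = 0"
    by (simp add: power_add field_simps)
  finally show ?thesis .
qed

lemma fourier_coeff_trapezoidal_kernel_Suc:
  "fourier_coeff (trapezoidal_kernel (Suc m)) k = of_real (trapezoidal_coeff m k)"
proof -
  \<comment> \<open>\<open>R\<close> exceeds the degrees of all four Fejer kernels, so they can be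
    combined coefficient by coefficient over \<open>{- int R..int R}\<close>.\<close>
  define R :: nat where "R = 2 ^ (m + 3)"
  have fejer: "fejer_kernel (2 ^ j - 1) z = (\<Sum>k\<in>{- int R..int R}. of_real (fejer_coeff (2 ^ j) k) * z powi k)"
    if "j \<le> m + 3" for j z
  proof -
    have "(2::nat) ^ j - 1 \<le> R"
      unfolding R_def using that by (intro order.trans[OF diff_le_self] power_increasing) auto
    moreover have "real (2 ^ j - 1) + 1 = 2 ^ j"
      by (simp add: of_nat_diff)
    ultimately show ?thesis
      using fejer_kernel_eq_sum by metis
  qed
  have "trapezoidal_kernel (Suc m) z
      = (\<Sum>k\<in>{- int R..int R}. of_real (trapezoidal_coeff m k) * z powi k)" for z
  proof -
    have "trapezoidal_kernel (Suc m) z = 2 * fejer_kernel (2 ^ (m + 3) - 1) z - fejer_kernel (2 ^ (m + 2) - 1) z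
        + fejer_kernel (2 ^ m - 1) z - 2 * fejer_kernel (2 ^ (m + 1) - 1) z"
      by (simp add: trapezoidal_kernel_def numeral_3_eq_3)
    also have "\<dots> = (\<Sum>k\<in>{- int R..int R}. of_real (trapezoidal_coeff m k) * z powi k)"
    proof -
      have j: "m + 3 \<le> m + 3" "m + 2 \<le> m + 3" "m \<le> m + 3" "m + 1 \<le> m + 3"
        by auto
      show ?thesis
        unfolding fejer[OF j(1)] fejer[OF j(2)] fejer[OF j(3)] fejer[OF j(4)] trapezoidal_coeff_def
          sum_distrib_left sum_subtractf[symmetric] sum.distrib[symmetric]
        by (intro sum.cong refl) (simp add: algebra_simps)
    qed
    finally show ?thesis .
  qed
  hence "fourier_coeff (trapezoidal_kernel (Suc m)) k
      = (if k \<in> {- int R..int R} then of_real (trapezoidal_coeff m k) else 0)"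
    by (intro fourier_coeff_laurent_polynomial) auto
  moreover have "trapezoidal_coeff m k = 0" if "k \<notin> {- int R..int R}"
    using that by (intro trapezoidal_coeff_eq_0_high) (auto simp: R_def)
  ultimately show ?thesis by auto
qed

text \<open>Negative frequencies drop out because \<open>taylor_coeff\<close> is 0 there, so the sum
  over all integers is cut off by the assumption on large non-negative frequencies alone.\<close>

lemma circle_conv_eq_sum:
  assumes "\<And>k. n \<le> k \<Longrightarrow> fourier_coeff T (int k) = 0"
  shows "circle_conv T F x = (\<Sum>k<n. fourier_coeff T (int k) * taylor_coeff F (int k) * x ^ k)"
proof -
  let ?f = "\<lambda>k. fourier_coeff T k * taylor_coeff F k * x powi k"
  have "circle_conv T F x = infsum ?f (int ` {..<n})"
    unfolding circle_conv_def
  proof (rule infsum_cong_neutral)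
    fix k assume k: "k \<in> UNIV - int ` {..<n}"
    show "?f k = 0"
    proof (cases "k < 0")
      case False
      hence "k = int (nat k)" by simp
      with k have "n \<le> nat k"
        by (metis DiffD2 image_eqI lessThan_iff not_le)
      with \<open>k = int (nat k)\<close> show ?thesis
        using assms[of "nat k"] by simp
    qed (simp add: taylor_coeff_def)
  qed auto
  also have "\<dots> = (\<Sum>k<n. ?f (int k))"
    by (simp add: sum.reindex)
  finally show ?thesis by simp
qed

text \<open>The cancellation at low frequencies supplies the lower end \<open>2 ^ m\<close> of the
  range. Without it all blocks would share coefficients and the independence argument would
  fail.\<close>

lemma circle_conv_trapezoidal_kernel_Suc:
  "circle_conv (trapezoidal_kernel (Suc m)) F x
     = (\<Sum>k\<in>{2 ^ m..<2 ^ (m + 3)}. of_real (trapezoidal_coeff m (int k)) * taylor_coeff F (int k) * x ^ k)"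
proof -
  have "circle_conv (trapezoidal_kernel (Suc m)) F x
      = (\<Sum>k<2 ^ (m + 3). of_real (trapezoidal_coeff m (int k)) * taylor_coeff F (int k) * x ^ k)"
  proof (subst circle_conv_eq_sum)
    show "fourier_coeff (trapezoidal_kernel (Suc m)) (int k) = 0" if "2 ^ (m + 3) \<le> k" for k
      unfolding fourier_coeff_trapezoidal_kernel_Suc
      using of_nat_mono[OF that, where 'a = int] by (subst trapezoidal_coeff_eq_0_high) auto
  qed (simp add: fourier_coeff_trapezoidal_kernel_Suc)
  also have "\<dots> = (\<Sum>k\<in>{2 ^ m..<2 ^ (m + 3)}. of_real (trapezoidal_coeff m (int k)) * taylor_coeff F (int k) * x ^ k)"
  proof (intro sum.mono_neutral_right ballI)
    fix k :: nat assume "k \<in> {..<2 ^ (m + 3)} - {2 ^ m..<2 ^ (m + 3)}"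
    hence "k \<le> 2 ^ m" by auto
    from of_nat_mono[OF this, where 'a = int]
    show "of_real (trapezoidal_coeff m (int k)) * taylor_coeff F (int k) * x ^ k = 0"
      by (simp add: trapezoidal_coeff_eq_0_low)
  qed auto
  finally show ?thesis .
qed

text \<open>The coefficient of the kernel at frequency \<open>-1\<close> meets a vanishing Taylor
  coefficient.\<close>

lemma circle_conv_trapezoidal_kernel_0:
  "circle_conv (trapezoidal_kernel 0) F x = taylor_coeff F 0 + taylor_coeff F 1 * x / 2"
proof -
  let ?\<alpha> = "\<lambda>k::int. if k = 0 then 1 else 1 / 2 :: complex"
  have fc: "fourier_coeff (trapezoidal_kernel 0) k = (if k \<in> {-1, 0, 1} then ?\<alpha> k else 0)" for k
    by (rule fourier_coeff_laurent_polynomial) (auto simp: trapezoidal_kernel_def power_int_minus)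
  have "circle_conv (trapezoidal_kernel 0) F x
      = (\<Sum>k<2. fourier_coeff (trapezoidal_kernel 0) (int k) * taylor_coeff F (int k) * x ^ k)"
    by (rule circle_conv_eq_sum) (auto simp: fc)
  thus ?thesis
    by (simp add: fc eval_nat_numeral)
qed

text \<open>The kernel of index 0 lies outside the shifted family; on the circle its contribution is
  bounded through the first two Taylor coefficients.\<close>

lemma sledd_seminorm_sq_finite:
  assumes "\<And>x N. norm x = 1 \<Longrightarrow> (\<Sum>m<N. (norm (circle_conv (trapezoidal_kernel (Suc m)) F x))\<^sup>2) \<le> C"
  shows "sledd_seminorm_sq F < \<infinity>"
proof -
  let ?D = "(norm (taylor_coeff F 0) + norm (taylor_coeff F 1))\<^sup>2 + C"
  have "(\<Sum>n. ennreal ((norm (circle_conv (trapezoidal_kernel n) F x))\<^sup>2)) \<le> ennreal ?D" if "norm x = 1" for x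
  proof (unfold suminf_eq_SUP, rule SUP_least)
    fix N
    let ?g = "\<lambda>n. (norm (circle_conv (trapezoidal_kernel n) F x))\<^sup>2"
    have "sum ?g {..<N} \<le> sum ?g {..<Suc N}"
      by (intro sum_mono2) auto
    also have "\<dots> = ?g 0 + (\<Sum>m<N. ?g (Suc m))"
      by (rule sum.lessThan_Suc_shift)
    also have "\<dots> \<le> ?D"
    proof (intro add_mono assms that power_mono norm_ge_zero)
      have "norm (taylor_coeff F 0 + taylor_coeff F 1 * x / 2)
          \<le> norm (taylor_coeff F 0) + norm (taylor_coeff F 1 * x / 2)"
        by (rule norm_triangle_ineq)
      also have "\<dots> \<le> norm (taylor_coeff F 0) + norm (taylor_coeff F 1)"
        using that by (simp add: norm_mult norm_divide)
      finally show "norm (circle_conv (trapezoidal_kernel 0) F x) \<le> norm (taylor_coeff F 0) + norm (taylor_coeff F 1)"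
        unfolding circle_conv_trapezoidal_kernel_0 .
    qed
    finally show "(\<Sum>n<N. ennreal (?g n)) \<le> ennreal ?D"
      by (subst sum_ennreal) (auto intro: ennreal_leI)
  qed
  hence "sledd_seminorm_sq F \<le> ennreal ?D"
    unfolding sledd_seminorm_sq_def by (intro SUP_least) auto
  thus ?thesis
    by (rule order.strict_trans1) auto
qed

text \<open>The tail suprema decrease by construction and are summable by assumption. A geometric
  sequence is added to make them strictly positive, since the blocks will be divided by
  \<open>b m\<close>.\<close>

lemma dyadic_majorant:
  assumes "(\<Sum>k. SUP n\<in>{Suc k..}. ennreal (dyadic_sq_sum a n)) < \<infinity>"
  obtains b :: "nat \<Rightarrow> real" where "\<And>m. b m > 0" "decseq b" "summable b"
    "\<And>j. dyadic_sq_sum a j \<le> b j"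
proof -
  define B where "B k = (SUP n\<in>{k..}. ennreal (dyadic_sq_sum a n))" for k
  have "B (Suc k) < \<infinity>" for k
  proof -
    have "B (Suc k) \<le> (\<Sum>k. B (Suc k))"
      by (rule sum_le_suminf[of _ "{k}", simplified]) auto
    thus ?thesis
      using assms unfolding B_def by (rule order.strict_trans1)
  qed
  \<comment> \<open>The assumed series starts at the tail from 1, so finiteness of the tail from 0
    is obtained by splitting off the term of index 0.\<close>
  moreover have "B 0 \<le> ennreal (dyadic_sq_sum a 0) + B (Suc 0)"
    unfolding B_def
  proof (rule SUP_least)
    fix n :: nat
    show "ennreal (dyadic_sq_sum a n) \<le> ennreal (dyadic_sq_sum a 0) + (SUP n\<in>{Suc 0..}. ennreal (dyadic_sq_sum a n))"
      by (cases "n = 0") (auto intro!: add_increasing SUP_upper)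
  qed
  hence "B 0 < \<infinity>"
    by (rule order.strict_trans1) (use \<open>\<And>k. B (Suc k) < \<infinity>\<close> in \<open>simp add: ennreal_add_less_top\<close>)
  ultimately have fin: "B k < \<infinity>" for k
    by (cases k) auto
  have mono: "B (Suc k) \<le> B k" for k
    unfolding B_def by (rule SUP_subset_mono) auto
  define b where "b k = enn2real (B k) + (1 / 2) ^ k" for k
  show ?thesis
  proof
    show "b m > 0" for m
      unfolding b_def by (intro add_nonneg_pos) auto
    show "decseq b"
      unfolding b_def using fin mono
      by (intro decseq_SucI add_mono enn2real_mono power_decreasing) auto
    have "summable (\<lambda>k. enn2real (B (Suc k)))"
    proof (rule summable_suminf_not_top)
      show "(\<Sum>k. ennreal (enn2real (B (Suc k)))) \<noteq> top"
        using assms fin unfolding B_def[symmetric] by (simp add: less_top)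
    qed auto
    hence "summable (\<lambda>k. enn2real (B k))"
      using summable_Suc_iff[of "\<lambda>k. enn2real (B k)"] by blast
    thus "summable b"
      unfolding b_def by (intro summable_add) auto
    show "dyadic_sq_sum a j \<le> b j" for j
    proof -
      have "ennreal (dyadic_sq_sum a j) \<le> B j"
        unfolding B_def by (rule SUP_upper) auto
      also have "\<dots> = ennreal (enn2real (B j))"
        using fin by (simp add: less_top)
      finally have "dyadic_sq_sum a j \<le> enn2real (B j)"
        by simp
      also have "\<dots> \<le> b j"
        by (simp add: b_def)
      finally show ?thesis .
    qed
  qed
qed

lemma sum_dyadic_sq_sum:
  assumes "m \<le> n"
  shows "(\<Sum>k\<in>{2 ^ m..<2 ^ n}. (a k)\<^sup>2) = (\<Sum>j\<in>{m..<n}. dyadic_sq_sum a j)"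
  using assms
proof (induction n rule: dec_induct)
  case (step n)
  have "(\<Sum>k\<in>{2 ^ m..<2 ^ Suc n}. (a k)\<^sup>2)
      = (\<Sum>k\<in>{2 ^ m..<2 ^ n}. (a k)\<^sup>2) + (\<Sum>k\<in>{2 ^ n..<2 ^ Suc n}. (a k)\<^sup>2)"
    using step by (intro sum.atLeastLessThan_concat[symmetric] power_increasing) auto
  with step show ?case
    by (simp add: dyadic_sq_sum_def)
qed simp

lemma summable_sq_of_dyadic_sq_sum_le:
  assumes "summable b" and b: "\<And>j. dyadic_sq_sum a j \<le> b j"
  shows "summable (\<lambda>n. (a n)\<^sup>2)"
proof (rule summableI_nonneg_bounded)
  have b_nonneg: "0 \<le> b j" for j
    by (rule order.trans[OF _ b]) (auto simp: dyadic_sq_sum_def intro: sum_nonneg)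
  fix N
  \<comment> \<open>The index 0 lies in no dyadic interval and is added by hand; the other indices
    below \<open>N\<close> are covered because \<open>N < 2 ^ N\<close>.\<close>
  have "(\<Sum>n<N. (a n)\<^sup>2) \<le> (\<Sum>n\<in>insert 0 {2 ^ 0..<2 ^ N}. (a n)\<^sup>2)"
  proof (intro sum_mono2)
    show "{..<N} \<subseteq> insert 0 {2 ^ 0..<2 ^ N}"
      using order.strict_trans[OF _ less_exp[of N]] by auto
  qed auto
  also have "\<dots> = (a 0)\<^sup>2 + (\<Sum>j\<in>{0..<N}. dyadic_sq_sum a j)"
    using sum_dyadic_sq_sum[of 0 N a] by simp
  also have "\<dots> \<le> (a 0)\<^sup>2 + (\<Sum>j\<in>{0..<N}. b j)"
    by (intro add_left_mono sum_mono b)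
  also have "\<dots> \<le> (a 0)\<^sup>2 + suminf b"
    using assms(1) b_nonneg by (intro add_left_mono sum_le_suminf) auto
  finally show "(\<Sum>n<N. (a n)\<^sup>2) \<le> (a 0)\<^sup>2 + suminf b" .
qed auto

section \<open>Combination of the probabilistic and analytic estimates\<close>

context gaussian_sequence
begin

text \<open>Dividing block \<open>m\<close> by \<open>sqrt (648 * b m)\<close> brings its variance
  below the threshold; undoing the division produces exactly the weights \<open>b m\<close> of the
  weighted square sum.\<close>

lemma AE_trapezoidal_blocks_bound:
  assumes b: "\<And>m. b m > 0" "decseq b" "summable b" "\<And>j. dyadic_sq_sum a j \<le> b j"
  shows "AE \<omega> in M. \<exists>C. \<forall>x N. norm x = 1 \<longrightarrow>
           (\<Sum>m<N. (norm (\<Sum>k\<in>{2 ^ m..<2 ^ (m + 3)}.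
              of_real (trapezoidal_coeff m (int k)) * (of_real (a k) * \<xi> k \<omega>) * x ^ k))\<^sup>2) \<le> C"
proof -
  \<comment> \<open>\<open>648 = 6 * 3 * 6\<^sup>2\<close>: three dyadic sums of size at most \<open>b m\<close>, coefficients at most \<open>6\<close>, target \<open>1 / 6\<close>.\<close>
  define c where "c m k = complex_of_real (trapezoidal_coeff m (int k) * a k / sqrt (648 * b m))" for m k
  have "(\<Sum>k\<in>{2 ^ m..<2 ^ (m + 3)}. (norm (c m k))\<^sup>2) \<le> 1 / 6" for m
  proof -
    have "(norm (c m k))\<^sup>2 \<le> 36 * (a k)\<^sup>2 / (648 * b m)" for k
    proof -
      have "(trapezoidal_coeff m (int k))\<^sup>2 \<le> 6\<^sup>2"
        using abs_trapezoidal_coeff_le by (intro abs_le_square_iff[THEN iffD1]) simp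
      hence "(trapezoidal_coeff m (int k))\<^sup>2 * (a k)\<^sup>2 / (648 * b m) \<le> 36 * (a k)\<^sup>2 / (648 * b m)"
        using b(1)[of m] by (intro divide_right_mono mult_right_mono) auto
      thus ?thesis
        using b(1)[of m] unfolding c_def norm_of_real by (simp add: power_divide power_mult_distrib)
    qed
    hence "(\<Sum>k\<in>{2 ^ m..<2 ^ (m + 3)}. (norm (c m k))\<^sup>2)
        \<le> (\<Sum>k\<in>{2 ^ m..<2 ^ (m + 3)}. 36 * (a k)\<^sup>2 / (648 * b m))"
      by (intro sum_mono)
    also have "\<dots> = 36 / (648 * b m) * (\<Sum>k\<in>{2 ^ m..<2 ^ (m + 3)}. (a k)\<^sup>2)"
      by (simp add: sum_distrib_left)
    also have "\<dots> = 36 / (648 * b m) * (\<Sum>j\<in>{m..<m + 3}. dyadic_sq_sum a j)"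
      by (subst sum_dyadic_sq_sum) auto
    \<comment> \<open>The block consists of the dyadic intervals \<open>m\<close>,
      \<open>m + 1\<close>, \<open>m + 2\<close>, and monotonicity of \<open>b\<close> bounds all
      three sums by \<open>b m\<close>.\<close>
    also have "\<dots> \<le> 36 / (648 * b m) * (\<Sum>j\<in>{m..<m + 3}. b m)"
    proof (intro mult_left_mono sum_mono)
      show "dyadic_sq_sum a j \<le> b m" if "j \<in> {m..<m + 3}" for j
        using b(4)[of j] decseqD[OF b(2), of m j] that by auto
    qed (use b(1)[of m] in simp)
    also have "\<dots> = 1 / 6"
      using b(1)[of m] by simp
    finally show ?thesis .
  qed
  from AE_weighted_square_sum_bound[OF this b(2) less_imp_le[OF b(1)] b(3)]
  show ?thesis
  proof eventually_elim
    case (elim \<omega>)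
    then obtain C where C: "\<And>x N. norm x = 1 \<Longrightarrow>
        (\<Sum>m<N. b m * (norm (\<Sum>k\<in>{2 ^ m..<2 ^ (m + 3)}. c m k * \<xi> k \<omega> * x ^ k))\<^sup>2) \<le> C"
      by blast
    have "(\<Sum>m<N. (norm (\<Sum>k\<in>{2 ^ m..<2 ^ (m + 3)}.
        of_real (trapezoidal_coeff m (int k)) * (of_real (a k) * \<xi> k \<omega>) * x ^ k))\<^sup>2) \<le> 648 * C"
      if "norm x = 1" for x N
    proof -
      have "(\<Sum>k\<in>{2 ^ m..<2 ^ (m + 3)}. of_real (trapezoidal_coeff m (int k)) * (of_real (a k) * \<xi> k \<omega>) * x ^ k)
          = of_real (sqrt (648 * b m)) * (\<Sum>k\<in>{2 ^ m..<2 ^ (m + 3)}. c m k * \<xi> k \<omega> * x ^ k)" for m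
        unfolding sum_distrib_left using b(1)[of m]
        by (intro sum.cong refl) (simp add: c_def field_simps)
      hence "(norm (\<Sum>k\<in>{2 ^ m..<2 ^ (m + 3)}. of_real (trapezoidal_coeff m (int k)) * (of_real (a k) * \<xi> k \<omega>) * x ^ k))\<^sup>2
          = 648 * (b m * (norm (\<Sum>k\<in>{2 ^ m..<2 ^ (m + 3)}. c m k * \<xi> k \<omega> * x ^ k))\<^sup>2)" for m
        using b(1)[of m] by (simp only: norm_mult norm_of_real power_mult_distrib) simp
      thus ?thesis
        using C[OF that, of N] by (simp add: sum_distrib_left[symmetric])
    qed
    thus ?case by blast
  qed
qed

end

theorem theorem1p3:
  fixes M :: "'w measure"
    and a :: "nat \<Rightarrow> real"
    and \<xi> :: "nat \<Rightarrow> 'w \<Rightarrow> complex"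
  assumes "prob_space M"
    and "\<And>n. a n \<ge> 0"
    and "prob_space.indep_vars M (\<lambda>_. borel) \<xi> UNIV"
    and "\<And>n. distributed M lborel (\<xi> n) std_complex_gaussian_density"
    and "(\<Sum>k. SUP n\<in>{Suc k..}. ennreal (dyadic_sq_sum a n)) < \<infinity>"
  shows "AE \<omega> in M.
           (\<forall>z\<in>ball 0 1. summable (\<lambda>n. of_real (a n) * \<xi> n \<omega> * z ^ n)) \<and>
           gaussian_series a \<xi> \<omega> \<in> sledd_space"
proof -
  interpret prob_space M by fact
  interpret gaussian_sequence M \<xi>
    by unfold_locales (use assms in auto)
  obtain b :: "nat \<Rightarrow> real" where b: "\<And>m. b m > 0" "decseq b" "summable b" "\<And>j. dyadic_sq_sum a j \<le> b j"
    by (rule dyadic_majorant[OF assms(5)], rule that)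
  \<comment> \<open>Square summability of the random coefficients yields both convergence in the
    disk and membership in the Hardy space.\<close>
  have "AE \<omega> in M. summable (\<lambda>n. (a n)\<^sup>2 * (norm (\<xi> n \<omega>))\<^sup>2)"
    by (rule AE_summable_norm_\<xi>_sq[OF _ summable_sq_of_dyadic_sq_sum_le[OF b(3,4)]]) simp
  with AE_trapezoidal_blocks_bound[OF b] show ?thesis
  proof eventually_elim
    case (elim \<omega>)
    let ?c = "\<lambda>n. of_real (a n) * \<xi> n \<omega>"
    let ?F = "gaussian_series a \<xi> \<omega>"
    have c: "summable (\<lambda>n. (norm (?c n))\<^sup>2)"
      using elim by (simp add: norm_mult power_mult_distrib)
    have summ: "summable (\<lambda>n. ?c n * z ^ n)" if "z \<in> ball 0 1" for z
      by (rule summable_power_series_ball[OF c that])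
    have F: "(\<lambda>n. ?c n * z ^ n) sums ?F z" if "z \<in> ball 0 1" for z
      unfolding gaussian_series_def using summ[OF that] by (rule summable_sums)
    have taylor: "taylor_coeff ?F (int k) = ?c k" for k
      using F by (rule taylor_coeff_power_series)
    \<comment> \<open>Once the Taylor coefficients are identified, the convolutions are literally
      the Gaussian block sums already bounded.\<close>
    obtain C where "\<And>x N. norm x = 1 \<Longrightarrow>
        (\<Sum>m<N. (norm (circle_conv (trapezoidal_kernel (Suc m)) ?F x))\<^sup>2) \<le> C"
      using elim(1) unfolding circle_conv_trapezoidal_kernel_Suc taylor by blast
    hence "sledd_seminorm_sq ?F < \<infinity>"
      by (rule sledd_seminorm_sq_finite)
    moreover have "?F \<in> hardy1"
      using c F by (rule hardy1_power_series)
    ultimately show ?case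
      using summ by (simp add: sledd_space_def)
  qed
qed

end
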